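(* The stabilizer group of the canonical $8$-form $\Omega^8_0$ on $\mathbb{R}^{16}$, under the natural action of the group $\mathrm{GL}(16,\mathbb{R})$ on $8$-forms, is the Lie group $\rho(\mathrm{Spin}(9))$.
   Context: Let $\mathbb{O}$ be the algebra of octonions with basis $u_0=1,u_1,\dots,u_7$ ($u_1,\dots,u_7$ the standard imaginary units) and scalar product $\langle x,y\rangle=\frac12(x\bar y+y\bar x)$. Identify $\mathbb{R}^{16}\equiv\mathbb{O}^2$ with scalar product $\langle(x_1,x_2),(y_1,y_2)\rangle=\langle x_1,y_1\rangle+\langle x_2,y_2\rangle$. Define the endomorphisms $I_0,\dots,I_8$ of $\mathbb{O}^2$ by $$I_i(x_1,x_2)=(u_i\bar x_2,\bar x_1u_i)\ \ (0\leqslant i\leqslant 7),\qquad I_8(x_1,x_2)=(-x_1,x_2).$$ They satisfy $I_iI_j+I_jI_i=0$ for $i\ne j$, $I_i^2=\mathrm{I}$, $I_i^T=I_i$, $\mathrm{tr}\,I_i=0$. The group $\rho(\mathrm{Spin}(9))\subset\mathrm{SO}(16)$ is the image of $\mathrm{Spin}(9)$ under its $16$-dimensional spin representation $\rho$ on $\mathbb{O}^2$ determined by the $I_i$: it is the group of all products of an even number of operators of the form $\sum_{i=0}^8 a_iI_i$ with $a_i\in\mathbb{R}$ and $\sum_i a_i^2=1$. For $i,j\in\{0,\dots,8\}$, $i\neq j$, let $\varpi_{ij}(X,Y)=\langle X,I_iI_jY\rangle$, a $2$-form on $\mathbb{O}^2$ (so $\varpi_{ij}=-\varpi_{ji}$),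 and let $\varpi_{ii}=0$. The canonical $8$-form on $\mathbb{R}^{16}$ is $$\Omega^8_0=\sum_{i,j,i',j'=0}^{8}\varpi_{ij}\wedge\varpi_{ij'}\wedge\varpi_{i'j}\wedge\varpi_{i'j'}.$$ *)

theory Defs
  imports "HOL-Analysis.Analysis" "HOL-Algebra.Group_Action" "HOL-Combinatorics.Permutations"
begin

subsection \<open>Octonions\<close>

text \<open>
  Octonions are obtained from the complex numbers by applying the Cayley--Dickson construction
  \<open>(a, b) (c, d) = (a c - d\<^sup>* b, d a + b c\<^sup>*)\<close>, \<open>(a, b)\<^sup>* = (a\<^sup>*, - b)\<close> twice. The Euclidean
  structure is the one of the product type; \<open>oct_inner\<close> below identifies it with
  \<open>(x y\<^sup>* + y x\<^sup>*) / 2\<close>.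
\<close>

type_synonym quat = "complex \<times> complex"
type_synonym oct = "quat \<times> quat"
type_synonym oct2 = "oct \<times> oct"

definition quat_mult :: "quat \<Rightarrow> quat \<Rightarrow> quat" where
  "quat_mult = (\<lambda>(a, b) (c, d). (a * c - cnj d * b, d * a + b * cnj c))"

definition quat_cnj :: "quat \<Rightarrow> quat" where
  "quat_cnj = (\<lambda>(a, b). (cnj a, - b))"

definition oct_mult :: "oct \<Rightarrow> oct \<Rightarrow> oct" where
  "oct_mult = (\<lambda>(a, b) (c, d).
     (quat_mult a c - quat_mult (quat_cnj d) b, quat_mult d a + quat_mult b (quat_cnj c)))"

definition oct_cnj :: "oct \<Rightarrow> oct" where
  "oct_cnj = (\<lambda>(a, b). (quat_cnj a, - b))"

text \<open>Only the indices \<open>0, \<dots>, 7\<close> are meaningful.\<close>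

definition oct_unit :: "nat \<Rightarrow> oct" where
  "oct_unit i =
     [((1, 0), (0, 0)), ((\<i>, 0), (0, 0)), ((0, 1), (0, 0)), ((0, \<i>), (0, 0)),
      ((0, 0), (1, 0)), ((0, 0), (\<i>, 0)), ((0, 0), (0, 1)), ((0, 0), (0, \<i>))] ! i"

lemma oct_inner:
  "(1 / 2) *\<^sub>R (oct_mult x (oct_cnj y) + oct_mult y (oct_cnj x)) = (x \<bullet> y) *\<^sub>R oct_unit 0"
  by (simp add: oct_mult_def oct_cnj_def quat_mult_def quat_cnj_def oct_unit_def inner_complex_def
        inner_prod_def case_prod_beta complex_eq_iff prod_eq_iff)


subsection \<open>The group \<open>\<rho>(Spin(9))\<close>\<close>

definition I_op :: "nat \<Rightarrow> oct2 \<Rightarrow> oct2" where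
  "I_op i = (\<lambda>(x1, x2).
     if i = 8 then (- x1, x2)
     else (oct_mult (oct_unit i) (oct_cnj x2), oct_mult (oct_cnj x1) (oct_unit i)))"

definition I_comb :: "(nat \<Rightarrow> real) \<Rightarrow> oct2 \<Rightarrow> oct2" where
  "I_comb a = (\<lambda>X. \<Sum>i\<le>8. a i *\<^sub>R I_op i X)"

definition rho_Spin9 :: "(oct2 \<Rightarrow> oct2) set" where
  "rho_Spin9 =
     {foldr (\<circ>) (map I_comb as) id | as.
        even (length as) \<and> (\<forall>a\<in>set as. (\<Sum>i\<le>8. (a i)\<^sup>2) = 1)}"

lemma oct_mult_polarized:
  "oct_mult u (oct_cnj (oct_mult (oct_cnj x) v)) + oct_mult v (oct_cnj (oct_mult (oct_cnj x) u))
     = (2 * (u \<bullet> v)) *\<^sub>R x"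
  "oct_mult (oct_cnj (oct_mult u (oct_cnj x))) v + oct_mult (oct_cnj (oct_mult v (oct_cnj x))) u
     = (2 * (u \<bullet> v)) *\<^sub>R x"
  by (simp add: oct_mult_def oct_cnj_def quat_mult_def quat_cnj_def inner_complex_def
        inner_prod_def case_prod_beta complex_eq_iff prod_eq_iff, simp add: algebra_simps)+

lemma oct_unit_orthonormal:
  assumes "i < 8" "j < 8"
  shows "oct_unit i \<bullet> oct_unit j = (if i = j then 1 else 0)"
proof -
  have "\<forall>i\<in>{..<8}. \<forall>j\<in>{..<8}. oct_unit i \<bullet> oct_unit j = (if i = j then 1 else 0)"
    by (simp add: oct_unit_def inner_complex_def lessThan_nat_numeral lessThan_Suc)
  with assms show ?thesis by auto
qed

lemma oct_mult_uminus: "oct_mult (- x) y = - oct_mult x y" "oct_mult x (- y) = - oct_mult x y"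
  by (simp add: oct_mult_def quat_mult_def quat_cnj_def case_prod_beta prod_eq_iff algebra_simps)+

lemma oct_cnj_uminus: "oct_cnj (- x) = - oct_cnj x"
  by (simp add: oct_cnj_def quat_cnj_def case_prod_beta prod_eq_iff)

lemma I_op_Clifford:
  assumes "i \<le> 8" "j \<le> 8"
  shows "I_op i (I_op j X) + I_op j (I_op i X) = (if i = j then 2 else 0) *\<^sub>R X"
proof -
  consider "i = 8" "j = 8" | "i = 8" "j < 8" | "i < 8" "j = 8" | "i < 8" "j < 8"
    using assms by linarith
  then show ?thesis
  proof cases
    case 4
    then show ?thesis
      by (cases X) (simp add: I_op_def oct_mult_polarized oct_unit_orthonormal zero_prod_def)
  qed (cases X; simp add: I_op_def oct_mult_uminus oct_cnj_uminus scaleR_2 zero_prod_def)+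
qed

lemma oct_inner_mult:
  "oct_mult u (oct_cnj x) \<bullet> y = x \<bullet> oct_mult (oct_cnj y) u"
  by (simp add: oct_mult_def oct_cnj_def quat_mult_def quat_cnj_def inner_complex_def
        inner_prod_def case_prod_beta, simp add: algebra_simps)

lemma I_op_symmetric: "I_op i X \<bullet> Y = X \<bullet> I_op i Y"
  by (cases X; cases Y) (simp add: I_op_def oct_inner_mult, metis oct_inner_mult inner_commute)


subsection \<open>Forms and the canonical 8-form\<close>

text \<open>
  A \<open>k\<close>-form is encoded as a function of a sequence of vectors that only looks at the
  entries \<open>0, \<dots>, k - 1\<close>. The wedge product is normalised so that
  \<open>(\<alpha> \<and> \<beta>) (v, w) = \<alpha> v * \<beta> w - \<alpha> w * \<beta> v\<close> for 1-forms; the degrees of the two factors are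
  explicit arguments.
\<close>

type_synonym 'a form = "(nat \<Rightarrow> 'a) \<Rightarrow> real"

definition wedge :: "nat \<Rightarrow> nat \<Rightarrow> 'a form \<Rightarrow> 'a form \<Rightarrow> 'a form" where
  "wedge k l \<alpha> \<beta> = (\<lambda>v.
     (\<Sum>\<sigma> | \<sigma> permutes {..<k + l}.
        of_int (sign \<sigma>) * \<alpha> (\<lambda>i. v (\<sigma> i)) * \<beta> (\<lambda>i. v (\<sigma> (k + i)))) / (fact k * fact l))"

definition varpi :: "nat \<Rightarrow> nat \<Rightarrow> oct2 form" where
  "varpi i j = (\<lambda>v. if i = j then 0 else v 0 \<bullet> I_op i (I_op j (v 1)))"

definition Omega8 :: "oct2 form" where
  "Omega8 = (\<lambda>v. \<Sum>i\<le>8. \<Sum>j\<le>8. \<Sum>i'\<le>8. \<Sum>j'\<le>8.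
     wedge 6 2 (wedge 4 2 (wedge 2 2 (varpi i j) (varpi i j')) (varpi i' j)) (varpi i' j') v)"


subsection \<open>The general linear group and its action on forms\<close>

definition GL :: "('a::euclidean_space \<Rightarrow> 'a) monoid" where
  "GL = \<lparr>carrier = {g. linear g \<and> bij g}, monoid.mult = (\<circ>), one = id\<rparr>"

text \<open>\<open>(g \<cdot> \<omega>) (v\<^sub>1, \<dots>, v\<^sub>k) = \<omega> (g\<inverse> v\<^sub>1, \<dots>, g\<inverse> v\<^sub>k)\<close>.\<close>

definition form_action :: "('a \<Rightarrow> 'a) \<Rightarrow> 'a form \<Rightarrow> 'a form" where
  "form_action g \<omega> = (\<lambda>v. \<omega> (\<lambda>i. inv_into UNIV g (v i)))"

lemma group_GL: "group (GL :: ('a::euclidean_space \<Rightarrow> 'a) monoid)"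
proof (rule groupI)
  fix g :: "'a \<Rightarrow> 'a" assume g: "g \<in> carrier GL"
  then have "linear (inv_into UNIV g)"
    by (auto simp: GL_def bij_def intro: inj_linear_imp_inv_linear)
  with g show "\<exists>h\<in>carrier GL. h \<otimes>\<^bsub>GL\<^esub> g = \<one>\<^bsub>GL\<^esub>"
    by (intro bexI[of _ "inv_into UNIV g"]) (auto simp: GL_def bij_imp_bij_inv bij_is_inj)
qed (auto simp: GL_def linear_compose bij_comp linear_id o_assoc)

lemma form_action_comp:
  assumes "bij g" "bij h"
  shows "form_action (g \<circ> h) = form_action g \<circ> form_action h"
  using assms by (auto simp: form_action_def o_inv_distrib fun_eq_iff)

lemma group_action_form_action:
  "group_action (GL :: ('a::euclidean_space \<Rightarrow> 'a) monoid) UNIV form_action"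
proof -
  have bij: "bij (form_action g)" if "bij g" for g :: "'a \<Rightarrow> 'a"
  proof (rule o_bij)
    have id: "form_action id = (id :: 'a form \<Rightarrow> 'a form)"
      by (simp add: form_action_def fun_eq_iff)
    with that show "form_action (inv_into UNIV g) \<circ> form_action g = id"
      by (simp add: bij_imp_bij_inv bij_is_inj flip: form_action_comp)
    have "g \<circ> inv_into UNIV g = id"
      using that by (simp add: bij_is_surj flip: surj_iff)
    with that id show "form_action g \<circ> form_action (inv_into UNIV g) = id"
      by (simp add: bij_imp_bij_inv flip: form_action_comp)
  qed
  have "form_action \<in> hom GL (BijGroup (UNIV :: 'a form set))"
    by (rule homI)
      (auto simp: BijGroup_def Bij_def GL_def compose_def bij form_action_comp fun_eq_iff)
  then show ?thesis
    unfolding group_action_def group_hom_def group_hom_axioms_def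
    by (simp add: group_GL group_BijGroup)
qed

end

theory Submission
  imports Defs
begin

text \<open>
  For a unit vector \<open>a\<close> of \<open>\<real>\<^sup>9\<close> write \<open>S\<^sub>a = \<Sum> a\<^sub>i I\<^sub>i\<close>. Conjugation by \<open>S\<^sub>a\<close> acts on the span of the \<open>I\<^sub>i\<close>
  as the negative of a reflection. The form is a complete contraction of forms \<open>\<varpi>\<^sub>i\<^sub>j\<close> with respect to
  the indices, hence is preserved by every \<open>S\<^sub>a\<close> (\<open>Omega8_I_comb\<close>) and so by \<^const>\<open>rho_Spin9\<close>. The
  identity \<open>I\<^sub>0 \<dots> I\<^sub>8 = 1\<close> (\<open>I_word_volume\<close>) turns products of odd length into products of even length, so
  that \<^const>\<open>rho_Spin9\<close> contains all products of the \<open>S\<^sub>a\<close>.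

  For the converse, let \<open>H\<close> be the Lie algebra of all linear operators that annihilate the form as
  derivations. The heart of the proof is that \<open>H\<close> is the span of the \<open>I\<^sub>i I\<^sub>j\<close> with \<open>i < j\<close>
  (\<open>stab_algebra_imp_span\<close>). Conjugations by the \<open>I\<^sub>i\<close> are commuting involutions of the space of
  operators that map \<open>H\<close> to itself, and each of their common eigenspaces is spanned by one product of
  an even number of distinct generators (\<open>sign_pattern_imp_I_word\<close>); so \<open>H\<close> is spanned by such
  products. Products of the same length are conjugate up to sign under the spin group, so either all
  or none of them belong to \<open>H\<close>, and four lengths have to be excluded. The identity (length 0) and
  \<open>I\<^sub>8\<close> (length 8) act as scalars on the octonionic line formed by the first component, hence multiply
  the value of the form on this line by a nonzero number. Length 6 together with length 2 would give
  all skew operators, among them one that moves just one vector of an orthonormal basis of the line out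
  of the line. Length 4 gives length 6 by taking a commutator. All that these arguments use of the form
  is that its value on the line does not vanish (\<open>Omega8_octonionic_line\<close>). This holds because
  left multiplications by the octonion units obey Clifford relations, which makes the \<open>8!\<close> terms of
  the alternating sum equal.

  An element \<open>g\<close> of the stabilizer normalizes \<open>H\<close>, so conjugation by \<open>g\<close> preserves the trace form on \<open>H\<close>
  and commutes with the associated Casimir operator. The span of the \<open>I\<^sub>i\<close> is an eigenspace of that
  operator (\<open>casimir_eigenspace\<close>). Consequently \<open>g I\<^sub>j g\<inverse>\<close> is the operator \<open>S\<close> of a vector \<open>a\<^sub>j\<close>, and the
  \<open>a\<^sub>j\<close> are orthonormal. A product \<open>k\<close> of operators \<open>S\<^sub>a\<close> rotates them back to the standard vectors
  (\<open>rho_Spin9_frame_to_basis\<close>), so that \<open>k g\<close> commutes with all generators and is a scalar. Since it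
  preserves a form of degree 8 it is \<open>\<plusminus> 1\<close>, and \<open>g\<close> is in the spin group.
\<close>

section \<open>Words in the Clifford generators\<close>

text \<open>
  Vectors of \<open>oct2\<close> are nested pairs. Without the two rules below, the simplifier keeps the
  quantifiers over them intact instead of splitting them into eight complex variables.
\<close>

declare split_paired_All [simp del] split_paired_Ex [simp del]

lemmas oct_defs = oct_mult_def oct_cnj_def quat_mult_def quat_cnj_def

lemma quat_linear:
  "quat_mult (a + b) c = quat_mult a c + quat_mult b c"
  "quat_mult c (a + b) = quat_mult c a + quat_mult c b"
  "quat_mult (r *\<^sub>R a) c = r *\<^sub>R quat_mult a c" "quat_mult c (r *\<^sub>R a) = r *\<^sub>R quat_mult c a"
  "quat_cnj (a + b) = quat_cnj a + quat_cnj b" "quat_cnj (r *\<^sub>R a) = r *\<^sub>R quat_cnj a"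
  by (simp_all add: quat_mult_def quat_cnj_def case_prod_beta prod_eq_iff algebra_simps)

lemma oct_linear:
  "oct_mult (x + y) z = oct_mult x z + oct_mult y z"
  "oct_mult z (x + y) = oct_mult z x + oct_mult z y"
  "oct_mult (r *\<^sub>R x) z = r *\<^sub>R oct_mult x z" "oct_mult z (r *\<^sub>R x) = r *\<^sub>R oct_mult z x"
  "oct_cnj (x + y) = oct_cnj x + oct_cnj y" "oct_cnj (r *\<^sub>R x) = r *\<^sub>R oct_cnj x"
  by (simp_all add: oct_mult_def oct_cnj_def case_prod_beta prod_eq_iff quat_linear
      scaleR_add_right scaleR_diff_right)

lemma linear_I_op: "linear (I_op i)"
  by (rule linearI) (simp_all add: I_op_def oct_linear case_prod_beta)

lemma I_op_I_op [simp]: "i \<le> 8 \<Longrightarrow> I_op i (I_op i x) = x"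
  using I_op_Clifford[of i i x] by (simp flip: scaleR_2)

definition commutation_sign :: "nat \<Rightarrow> nat \<Rightarrow> real" where
  "commutation_sign i j = (if i = j then 1 else - 1)"

lemma I_op_commute:
  assumes "i \<le> 8" "j \<le> 8"
  shows "I_op i (I_op j x) = commutation_sign i j *\<^sub>R I_op j (I_op i x)"
  using I_op_Clifford[OF assms, of x] by (auto simp: commutation_sign_def eq_neg_iff_add_eq_0)

definition I_word :: "nat list \<Rightarrow> oct2 \<Rightarrow> oct2" where
  "I_word xs = foldr (\<circ>) (map I_op xs) id"

lemma I_word_simps [simp]:
  "I_word [] y = y" "I_word (x # xs) y = I_op x (I_word xs y)"
  by (simp_all add: I_word_def)

lemma I_word_append: "I_word (xs @ ys) y = I_word xs (I_word ys y)"
  by (induction xs) auto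

lemma linear_I_word: "linear (I_word xs)"
proof (induction xs)
  case Nil
  show ?case by (simp add: I_word_def linear_iff)
next
  case (Cons x xs)
  from linear_compose[OF this linear_I_op[of x]] show ?case
    by (simp add: I_word_def o_def)
qed

lemmas I_op_linear_simps =
  linear_add[OF linear_I_op] linear_scale[OF linear_I_op] linear_neg[OF linear_I_op]
  linear_sum[OF linear_I_op] linear_diff[OF linear_I_op]

lemma I_op_I_word:
  assumes "i \<le> 8" "set xs \<subseteq> {..8}"
  shows "I_op i (I_word xs y) = (\<Prod>x\<leftarrow>xs. commutation_sign i x) *\<^sub>R I_word xs (I_op i y)"
  using assms(2)
proof (induction xs)
  case (Cons x xs)
  then show ?case using assms(1)
    by (simp add: I_op_commute[of i x] I_op_linear_simps)
qed auto

lemma prod_commutation_sign: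
  assumes "distinct xs"
  shows "(\<Prod>x\<leftarrow>xs. commutation_sign i x) = (- 1) ^ length xs * (if i \<in> set xs then - 1 else 1)"
  using assms by (induction xs) (auto simp: commutation_sign_def)

lemma I_word_rev_cancel:
  assumes "set xs \<subseteq> {..8}"
  shows "I_word xs (I_word (rev xs) y) = y"
  using assms by (induction xs arbitrary: y) (auto simp: I_word_append)

lemma I_word_rev:
  assumes "distinct xs" "set xs \<subseteq> {..8}"
  shows "I_word (rev xs) y = (- 1) ^ (length xs choose 2) *\<^sub>R I_word xs y"
  using assms
proof (induction xs arbitrary: y)
  case (Cons x xs)
  have "I_op x (I_word xs y) = (- 1) ^ length xs *\<^sub>R I_word xs (I_op x y)"
    using Cons.prems by (simp add: I_op_I_word prod_commutation_sign)
  then have "I_word xs (I_op x y) = (- 1) ^ length xs *\<^sub>R I_op x (I_word xs y)"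
    by (simp flip: power_add mult_2)
  then show ?case
    using Cons by (simp add: I_word_append numeral_2_eq_2 power_add)
qed (simp add: numeral_2_eq_2)

lemma I_word_adjoint: "I_word xs x \<bullet> y = x \<bullet> I_word (rev xs) y"
  by (induction xs arbitrary: x y) (simp_all add: I_word_append I_op_symmetric)

lemma oct_expand: "x = (\<Sum>k<8. (x \<bullet> oct_unit k) *\<^sub>R oct_unit k)"
proof -
  obtain a b c d where "x = ((a, b), (c, d))"
    by (metis surj_pair)
  then show ?thesis
    by (simp add: lessThan_nat_numeral lessThan_Suc oct_unit_def inner_complex_def complex_eq_iff)
qed

lemma I_op_unit:
  assumes "k < 8"
  shows "I_op k (oct_unit 0, 0) = (0, oct_unit k)"
proof -
  have "\<forall>k\<in>{..<8}. I_op k (oct_unit 0, 0) = (0, oct_unit k)"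
    by (simp add: lessThan_nat_numeral lessThan_Suc I_op_def oct_defs oct_unit_def case_prod_beta
      prod_eq_iff)
  with assms show ?thesis by auto
qed

lemma sum_Pair_0: "(\<Sum>k\<in>K. (0, f k)) = (0, \<Sum>k\<in>K. f k)"
  by (induction K rule: infinite_finite_induct) (auto simp: zero_prod_def)

text \<open>The module \<open>\<real>\<^sup>1\<^sup>6\<close> has only scalar endomorphisms. Three words, one for each of three quaternion
  subalgebras that intersect in the real line, fix the vector \<open>e = (1, 0)\<close> and negate \<open>(u\<^sub>k, 0)\<close> for
  every \<open>u\<^sub>k\<close> outside of their subalgebra. An operator that commutes with the generators therefore
  maps \<open>e\<close> to a multiple of itself, and \<open>e\<close> generates the module.\<close>

lemma linear_eq_scaleR_if_commutes:
  assumes X: "linear X" and comm: "\<And>i x. i \<le> 8 \<Longrightarrow> X (I_op i x) = I_op i (X x)"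
  obtains c where "\<And>x. X x = c *\<^sub>R x"
proof -
  define e :: oct2 where "e = (oct_unit 0, 0)"
  have e8: "I_op 8 e = - e"
    by (simp add: I_op_def e_def)
  obtain z y where Xe: "X e = (z, y)"
    by (metis surj_pair)
  have "- y = y"
    using comm[of 8 e] by (simp add: e8 Xe linear_neg[OF X]) (simp add: I_op_def)
  then have y: "y = 0"
    by (simp add: prod_eq_iff complex_eq_iff)
  \<comment> \<open>Each list starts with the three imaginary units of a quaternion subalgebra.\<close>
  define H :: "nat list set" where "H = {[1, 2, 3, 0], [1, 4, 5, 0], [2, 4, 6, 0]}"
  have He: "I_word xs e = e" if "xs \<in> H" for xs
    using that by (auto simp: H_def e_def I_op_def oct_defs oct_unit_def case_prod_beta prod_eq_iff)
  have Hk: "\<exists>xs\<in>H. I_word xs (oct_unit k, 0) = - (oct_unit k, 0)" if "0 < k" "k < 8" for k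
  proof -
    have "k \<in> {1, 2, 3, 4, 5, 6, 7}"
      using that by auto
    then show ?thesis
      by (auto simp: H_def I_op_def oct_defs oct_unit_def case_prod_beta prod_eq_iff)
  qed
  have z0: "z \<bullet> oct_unit k = 0" if k: "0 < k" "k < 8" for k
  proof -
    obtain xs where xs: "xs \<in> H" "I_word xs (oct_unit k, 0) = - (oct_unit k, 0)"
      using Hk[OF k] by blast
    have props: "distinct xs" "set xs \<subseteq> {..8}" "length xs = 4"
      using xs(1) by (auto simp: H_def)
    have word: "I_word ys (X v) = X (I_word ys v)" if "set ys \<subseteq> {..8}" for ys v
      using that by (induction ys) (auto simp: comm)
    have "X e \<bullet> (oct_unit k, 0) = I_word xs (X e) \<bullet> (oct_unit k, 0)"
      by (simp add: word props He xs(1))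
    also have "\<dots> = X e \<bullet> I_word (rev xs) (oct_unit k, 0)"
      by (rule I_word_adjoint)
    also have "\<dots> = - (X e \<bullet> (oct_unit k, 0))"
      by (simp only: I_word_rev[OF props(1,2)] props(3) xs(2)) (simp add: choose_two del: uminus_Pair)
    finally show ?thesis
      by (simp add: Xe)
  qed
  obtain c where Xe': "X e = c *\<^sub>R e"
  proof
    have "z = (\<Sum>k<8. (z \<bullet> oct_unit k) *\<^sub>R oct_unit k)"
      by (rule oct_expand)
    also have "\<dots> = (\<Sum>k<(8::nat). if k = 0 then (z \<bullet> oct_unit 0) *\<^sub>R oct_unit 0 else 0)"
      by (intro sum.cong) (auto simp: z0)
    finally have "z = (z \<bullet> oct_unit 0) *\<^sub>R oct_unit 0"
      by simp
    then show "X e = (z \<bullet> oct_unit 0) *\<^sub>R e"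
      by (metis Xe y e_def scaleR_Pair scaleR_zero_right)
  qed
  have right: "X (0, y) = c *\<^sub>R (0, y)" for y
  proof -
    have y: "(0, y) = (\<Sum>k<8. (y \<bullet> oct_unit k) *\<^sub>R I_op k e)"
      using oct_expand[of y] by (simp add: I_op_unit e_def sum_Pair_0)
    have "X (0, y) = (\<Sum>k<8. (y \<bullet> oct_unit k) *\<^sub>R X (I_op k e))"
      unfolding y by (simp only: linear_sum[OF X] linear_scale[OF X])
    also have "\<dots> = c *\<^sub>R (0, y)"
      unfolding y by (simp add: comm Xe' I_op_linear_simps scaleR_sum_right mult.commute)
    finally show ?thesis .
  qed
  have left: "X (x, 0) = c *\<^sub>R (x, 0)" for x
  proof -
    have x: "(x, 0) = I_op 0 (0, oct_cnj x)"
      by (cases x) (simp add: I_op_def oct_defs oct_unit_def case_prod_beta prod_eq_iff)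
    have "X (x, 0) = I_op 0 (X (0, oct_cnj x))"
      unfolding x by (rule comm) simp
    also have "\<dots> = c *\<^sub>R (x, 0)"
      unfolding x right by (simp only: I_op_linear_simps)
    finally show ?thesis .
  qed
  have "X x = c *\<^sub>R x" for x
    using linear_add[OF X, of "(fst x, 0)" "(0, snd x)"] by (simp add: left right prod_eq_iff)
  then show thesis
    by (rule that)
qed

text \<open>In odd dimension the volume element is central, hence a scalar; its value is read off at one vector.
  It completes products of an odd number of unit vectors to elements of \<^const>\<open>rho_Spin9\<close>.\<close>

lemma I_word_volume: "I_word [0..<9] x = x"
proof -
  have "I_word [0..<9] (I_op i y) = I_op i (I_word [0..<9] y)" if "i \<le> 8" for i y
    using that by (subst I_op_I_word) (auto simp: prod_commutation_sign)
  then obtain c where c: "\<And>x. I_word [0..<9] x = c *\<^sub>R x"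
    using linear_eq_scaleR_if_commutes[OF linear_I_word[of "[0..<9]"]] by blast
  have "I_word [0..<9] (oct_unit 0, 0) = (oct_unit 0, 0)"
    by (simp add: upt_rec I_op_def oct_defs oct_unit_def case_prod_beta prod_eq_iff)
  then have "c = 1"
    unfolding c by (simp add: oct_unit_def complex_eq_iff)
  with c show ?thesis by simp
qed

section \<open>Operators with a sign pattern\<close>

text \<open>Conjugation by the generators gives commuting involutions of the space of operators, and
  \<open>\<epsilon>\<close> records the eigenvalues of a common eigenvector.\<close>

definition sign_pattern :: "(nat \<Rightarrow> real) \<Rightarrow> (oct2 \<Rightarrow> oct2) \<Rightarrow> bool" where
  "sign_pattern \<epsilon> X \<longleftrightarrow>
     (\<forall>i\<le>8. \<epsilon> i \<in> {1, - 1} \<and> (\<forall>x. I_op i (X x) = \<epsilon> i *\<^sub>R X (I_op i x)))"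

lemma I_word_sign_pattern:
  assumes X: "linear X" "sign_pattern \<epsilon> X" and xs: "set xs \<subseteq> {..8}"
  shows "I_word xs (X y) = (\<Prod>x\<leftarrow>xs. \<epsilon> x) *\<^sub>R X (I_word xs y)"
  using xs
proof (induction xs)
  case (Cons x xs)
  then show ?case using X(2)
    by (auto simp: sign_pattern_def I_op_linear_simps)
qed auto

lemma prod_signs:
  fixes \<epsilon> :: "nat \<Rightarrow> real"
  assumes "\<And>i. i \<in> set xs \<Longrightarrow> \<epsilon> i \<in> {1, - 1}"
  shows "(\<Prod>x\<leftarrow>xs. \<epsilon> x) = (- 1) ^ length (filter (\<lambda>i. \<epsilon> i = - 1) xs)"
  using assms by (induction xs) auto

lemma sign_pattern_prod:
  assumes X: "linear X" "sign_pattern \<epsilon> X" and ne: "X x \<noteq> 0"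
  shows "(\<Prod>i\<leftarrow>[0..<9]. \<epsilon> i) = 1"
proof -
  have "I_word [0..<9] (X x) = (\<Prod>i\<leftarrow>[0..<9]. \<epsilon> i) *\<^sub>R X (I_word [0..<9] x)"
    by (intro I_word_sign_pattern X) auto
  then have "(\<Prod>i\<leftarrow>[0..<9]. \<epsilon> i) *\<^sub>R X x = 1 *\<^sub>R X x"
    by (simp only: I_word_volume scaleR_one)
  then show ?thesis
    using ne by (metis scaleR_cancel_right)
qed

text \<open>The word formed by the indices \<open>i\<close> with \<open>\<epsilon> i = - 1\<close> has the sign pattern \<open>\<epsilon>\<close> as well, because the
  volume element forces its length to be even. The quotient of the two operators then commutes with
  all generators and is a scalar.\<close>

lemma sign_pattern_imp_I_word:
  assumes X: "linear X" "sign_pattern \<epsilon> X" and ne: "X x \<noteq> 0"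
  defines "xs \<equiv> filter (\<lambda>i. \<epsilon> i = - 1) [0..<9]"
  obtains c where "even (length xs)" "X = (\<lambda>x. c *\<^sub>R I_word xs x)"
proof -
  have sgn: "\<epsilon> i \<in> {1, - 1}" if "i \<le> 8" for i
    using X(2) that by (auto simp: sign_pattern_def)
  have "(\<Prod>i\<leftarrow>[0..<9]. \<epsilon> i) = (- 1) ^ length xs"
    unfolding xs_def by (rule prod_signs) (use sgn in \<open>simp add: less_Suc_eq_le\<close>)
  then have even: "even (length xs)"
    using sign_pattern_prod[OF X ne] by (auto simp: minus_one_power_iff split: if_splits)
  have xs: "distinct xs" "set xs \<subseteq> {..8}"
    by (auto simp: xs_def)
  have "X (I_word (rev xs) (I_op i y)) = I_op i (X (I_word (rev xs) y))" if i: "i \<le> 8" for i y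
  proof -
    have eps: "(if i \<in> set (rev xs) then - 1 else 1) = \<epsilon> i"
      using sgn[OF i] i by (auto simp: xs_def)
    have "I_op i (I_word (rev xs) y) = \<epsilon> i *\<^sub>R I_word (rev xs) (I_op i y)"
      using I_op_I_word[OF i, of "rev xs" y] xs even prod_commutation_sign[of "rev xs" i] unfolding eps by simp
    moreover have "I_op i (X z) = \<epsilon> i *\<^sub>R X (I_op i z)" for z
      using X(2) i by (simp add: sign_pattern_def)
    ultimately show ?thesis
      using sgn[OF i] by (auto simp: linear_scale[OF X(1)] linear_neg[OF X(1)])
  qed
  then obtain c where c: "\<And>y. X (I_word (rev xs) y) = c *\<^sub>R y"
    using linear_eq_scaleR_if_commutes[of "\<lambda>y. X (I_word (rev xs) y)"]
      linear_compose[OF linear_I_word X(1), of "rev xs"] unfolding o_def by blast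
  have "X y = c *\<^sub>R I_word xs y" for y
    using c[of "I_word xs y"] I_word_rev_cancel[of "rev xs" y] xs by simp
  with even show thesis
    by (intro that) auto
qed

text \<open>Simultaneous diagonalization of the nine involutions: the projections onto the eigenspaces of
  one of them preserve \<open>W\<close> and the eigenvalues with respect to the others, so an element of \<open>W\<close> is
  split into common eigenvectors in nine steps.\<close>

lemma sign_pattern_induct:
  assumes "X \<in> W"
    and linear: "\<And>X. X \<in> W \<Longrightarrow> linear X"
    and closed: "\<And>X i s. X \<in> W \<Longrightarrow> i \<le> 8 \<Longrightarrow> s \<in> {1, - 1} \<Longrightarrow>
      (\<lambda>x. (1 / 2) *\<^sub>R (X x + s *\<^sub>R I_op i (X (I_op i x)))) \<in> W"
    and add: "\<And>X Y. X \<in> S \<Longrightarrow> Y \<in> S \<Longrightarrow> (\<lambda>x. X x + Y x) \<in> S"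
    and base: "\<And>X \<epsilon>. X \<in> W \<Longrightarrow> sign_pattern \<epsilon> X \<Longrightarrow> X \<in> S"
  shows "X \<in> S"
proof -
  have "0 \<le> (9 :: nat)" by simp
  then have "\<forall>X \<epsilon>. X \<in> W \<longrightarrow>
      (\<forall>i<0. \<epsilon> i \<in> {1, - 1} \<and> (\<forall>x. I_op i (X x) = \<epsilon> i *\<^sub>R X (I_op i x))) \<longrightarrow> X \<in> S"
  proof (induction rule: inc_induct)
    case base
    show ?case
    proof (intro allI impI)
      fix X \<epsilon>
      assume "X \<in> W" "\<forall>i<9. \<epsilon> i \<in> {1, - 1} \<and> (\<forall>x. I_op i (X x) = \<epsilon> i *\<^sub>R X (I_op i x))"
      moreover have "i < 9" if "i \<le> 8" for i :: nat
        using that by simp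
      ultimately show "X \<in> S"
        by (intro assms(5)[of X \<epsilon>]) (auto simp only: sign_pattern_def)
    qed
  next
    case (step n)
    show ?case
    proof (intro allI impI)
      fix X :: "oct2 \<Rightarrow> oct2" and \<epsilon> :: "nat \<Rightarrow> real"
      assume XW: "X \<in> W"
        and X: "\<forall>i<n. \<epsilon> i \<in> {1, - 1} \<and> (\<forall>x. I_op i (X x) = \<epsilon> i *\<^sub>R X (I_op i x))"
      define Y where "Y s x = (1 / 2) *\<^sub>R (X x + s *\<^sub>R I_op n (X (I_op n x)))" for s x
      have "Y s \<in> S" if s: "s \<in> {1, - 1}" for s
      proof -
        have "Y s \<in> W"
          unfolding Y_def using closed[OF XW _ s, of n] step.hyps by simp
        moreover have "I_op i (Y s x) = (\<epsilon>(n := s)) i *\<^sub>R Y s (I_op i x)" if "i < Suc n" for i x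
        proof (cases "i = n")
          case True
          then show ?thesis
            using s step.hyps
            by (auto simp: Y_def I_op_linear_simps algebra_simps)
        next
          case False
          with that have i: "i < n" by simp
          have anti: "I_op i (I_op n y) = - I_op n (I_op i y)" for y
            using i step.hyps by (simp add: I_op_commute[of i n] commutation_sign_def)
          show ?thesis
            using i X by (simp add: Y_def anti I_op_linear_simps linear_neg[OF linear[OF XW]]
              scaleR_add_right)
        qed
        moreover have "(\<epsilon>(n := s)) i \<in> {1, - 1}" if "i < Suc n" for i
          using X s that by (auto simp: less_Suc_eq)
        ultimately show ?thesis
          using step.IH by blast
      qed
      then have "(\<lambda>x. Y 1 x + Y (- 1) x) \<in> S"
        by (intro add) auto
      also have "(\<lambda>x. Y 1 x + Y (- 1) x) = X"
        by (simp add: Y_def flip: scaleR_add_left scaleR_add_right)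
      finally show "X \<in> S" .
    qed
  qed
  with \<open>X \<in> W\<close> show ?thesis by blast
qed

section \<open>The canonical form as an alternating sum\<close>

definition Alt :: "nat \<Rightarrow> 'a form \<Rightarrow> 'a form" where
  "Alt n f v = (\<Sum>\<sigma> | \<sigma> permutes {..<n}. of_int (sign \<sigma>) * f (\<lambda>i. v (\<sigma> i)))"

lemma wedge_eq_Alt:
  "wedge k l \<alpha> \<beta> v = Alt (k + l) (\<lambda>v. \<alpha> v * \<beta> (\<lambda>i. v (k + i))) v / (fact k * fact l)"
  by (simp add: wedge_def Alt_def mult.assoc)

text \<open>A permutation of the first \<open>k\<close> entries is also a permutation of all entries, so the inner
  alternation merely repeats the outer one \<open>k!\<close> times.\<close>

lemma Alt_absorb:
  "Alt (k + l) (\<lambda>v. Alt k \<alpha> v * \<beta> (\<lambda>i. v (k + i))) v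
     = fact k * Alt (k + l) (\<lambda>v. \<alpha> v * \<beta> (\<lambda>i. v (k + i))) v"
proof -
  let ?S = "{\<sigma>. \<sigma> permutes {..<k + l}}" and ?T = "{\<tau>. \<tau> permutes {..<k}}"
  let ?h = "\<lambda>\<sigma>. \<alpha> (\<lambda>i. v (\<sigma> i)) * \<beta> (\<lambda>i. v (\<sigma> (k + i)))"
  have "Alt (k + l) (\<lambda>v. Alt k \<alpha> v * \<beta> (\<lambda>i. v (k + i))) v
      = (\<Sum>\<sigma>\<in>?S. \<Sum>\<tau>\<in>?T. of_int (sign \<sigma>) * of_int (sign \<tau>) *
           (\<alpha> (\<lambda>i. v (\<sigma> (\<tau> i))) * \<beta> (\<lambda>i. v (\<sigma> (k + i)))))"
    by (simp add: Alt_def sum_distrib_left sum_distrib_right mult_ac)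
  also have "\<dots> = (\<Sum>\<sigma>\<in>?S. \<Sum>\<tau>\<in>?T. of_int (sign (\<sigma> \<circ> \<tau>)) * ?h (\<sigma> \<circ> \<tau>))"
  proof (intro sum.cong refl)
    fix \<sigma> \<tau> assume \<sigma>: "\<sigma> \<in> ?S" and "\<tau> \<in> ?T"
    then have \<tau>: "\<tau> permutes {..<k}" by simp
    have "\<tau> (k + i) = k + i" for i
      using permutes_not_in[OF \<tau>] by simp
    moreover have "sign (\<sigma> \<circ> \<tau>) = sign \<sigma> * sign \<tau>"
      using \<tau> \<sigma> by (intro sign_compose) (auto intro: permutes_imp_permutation[OF finite_lessThan])
    ultimately show "of_int (sign \<sigma>) * of_int (sign \<tau>) *
           (\<alpha> (\<lambda>i. v (\<sigma> (\<tau> i))) * \<beta> (\<lambda>i. v (\<sigma> (k + i)))) = of_int (sign (\<sigma> \<circ> \<tau>)) * ?h (\<sigma> \<circ> \<tau>)"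
      by simp
  qed
  also have "\<dots> = (\<Sum>\<tau>\<in>?T. \<Sum>\<sigma>\<in>?S. of_int (sign (\<sigma> \<circ> \<tau>)) * ?h (\<sigma> \<circ> \<tau>))"
    by (rule sum.swap)
  also have "\<dots> = (\<Sum>\<tau>\<in>?T. \<Sum>\<sigma>\<in>?S. of_int (sign \<sigma>) * ?h \<sigma>)"
  proof (rule sum.cong[OF refl])
    fix \<tau> assume "\<tau> \<in> ?T"
    then have "\<tau> permutes {..<k + l}"
      by (auto intro: permutes_subset)
    from sum_permutations_compose_right[OF this, of "\<lambda>\<sigma>. of_int (sign \<sigma>) * ?h \<sigma>"]
    show "(\<Sum>\<sigma>\<in>?S. of_int (sign (\<sigma> \<circ> \<tau>)) * ?h (\<sigma> \<circ> \<tau>)) = (\<Sum>\<sigma>\<in>?S. of_int (sign \<sigma>) * ?h \<sigma>)"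
      by simp
  qed
  also have "\<dots> = fact k * Alt (k + l) (\<lambda>v. \<alpha> v * \<beta> (\<lambda>i. v (k + i))) v"
    by (simp add: Alt_def card_permutations[OF refl] mult.assoc)
  finally show ?thesis .
qed

lemma Alt_divide: "Alt n (\<lambda>v. f v / c) v = Alt n f v / c"
  by (simp add: Alt_def sum_divide_distrib)

lemma Alt_sum: "Alt n (\<lambda>v. \<Sum>i\<in>I. f i v) v = (\<Sum>i\<in>I. Alt n (f i) v)"
  by (simp add: Alt_def sum_distrib_left sum.swap[of _ _ I])

lemma wedge_Alt:
  "wedge k l (\<lambda>v. Alt k \<alpha> v / c) \<beta> v
     = Alt (k + l) (\<lambda>v. \<alpha> v * \<beta> (\<lambda>i. v (k + i))) v / (c * fact l)"
  using Alt_absorb[of k l \<alpha> \<beta> v]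
  by (simp add: wedge_eq_Alt Alt_divide)

text \<open>For antisymmetric matrices this is the trace of the product \<open>A B D C\<close>. The index pattern is the one
  of the canonical form.\<close>

definition contraction :: "(nat \<Rightarrow> nat \<Rightarrow> real) \<Rightarrow> (nat \<Rightarrow> nat \<Rightarrow> real) \<Rightarrow> (nat \<Rightarrow> nat \<Rightarrow> real) \<Rightarrow> (nat \<Rightarrow> nat \<Rightarrow> real) \<Rightarrow> real" where
  "contraction A B C D = (\<Sum>i\<le>8. \<Sum>j\<le>8. \<Sum>i'\<le>8. \<Sum>j'\<le>8. A i j * B i j' * C i' j * D i' j')"

definition four_fold :: "(nat \<Rightarrow> nat \<Rightarrow> 'a form) \<Rightarrow> 'a form" where
  "four_fold \<omega> v = contraction (\<lambda>i j. \<omega> i j v) (\<lambda>i j. \<omega> i j (\<lambda>k. v (2 + k)))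
     (\<lambda>i j. \<omega> i j (\<lambda>k. v (4 + k))) (\<lambda>i j. \<omega> i j (\<lambda>k. v (6 + k)))"

lemma Omega8_eq_Alt: "Omega8 v = Alt 8 (four_fold varpi) v / 16"
proof -
  have "wedge 6 2 (wedge 4 2 (wedge 2 2 \<alpha> \<beta>) \<gamma>) \<delta> v
      = Alt 8 (\<lambda>v. \<alpha> v * \<beta> (\<lambda>i. v (2 + i)) * \<gamma> (\<lambda>i. v (4 + i)) * \<delta> (\<lambda>i. v (6 + i))) v / 16"
    for \<alpha> \<beta> \<gamma> \<delta> :: "oct2 form"
  proof -
    have 1: "wedge 2 2 \<alpha> \<beta> = (\<lambda>v. Alt 4 (\<lambda>v. \<alpha> v * \<beta> (\<lambda>i. v (2 + i))) v / 4)"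
      by (simp add: wedge_eq_Alt fun_eq_iff)
    have 2: "wedge 4 2 (wedge 2 2 \<alpha> \<beta>) \<gamma>
        = (\<lambda>v. Alt 6 (\<lambda>v. \<alpha> v * \<beta> (\<lambda>i. v (2 + i)) * \<gamma> (\<lambda>i. v (4 + i))) v / 8)"
      unfolding 1 by (simp add: wedge_Alt fun_eq_iff)
    show ?thesis
      unfolding 2 by (simp add: wedge_Alt)
  qed
  then show ?thesis
    by (simp only: Omega8_def four_fold_def[abs_def] contraction_def Alt_sum sum_divide_distrib)
qed

lemma orthogonal_inner_product:
  fixes R :: "nat \<Rightarrow> nat \<Rightarrow> real"
  assumes R: "\<And>k l. k \<le> 8 \<Longrightarrow> l \<le> 8 \<Longrightarrow> (\<Sum>i\<le>8. R i k * R i l) = (if k = l then 1 else 0)"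
  shows "(\<Sum>i\<le>8. (\<Sum>k\<le>8. R i k * x k) * (\<Sum>l\<le>8. R i l * y l)) = (\<Sum>i\<le>8. x i * y i)"
proof -
  have "(\<Sum>i\<le>8. (\<Sum>k\<le>8. R i k * x k) * (\<Sum>l\<le>8. R i l * y l))
      = (\<Sum>i\<le>8. \<Sum>k\<le>8. \<Sum>l\<le>8. R i k * R i l * (x k * y l))"
    by (simp add: sum_product mult_ac)
  also have "\<dots> = (\<Sum>k\<le>8. \<Sum>l\<le>8. (\<Sum>i\<le>8. R i k * R i l) * (x k * y l))"
    by (subst sum.swap, rule sum.cong[OF refl], subst sum.swap) (simp add: sum_distrib_right)
  also have "\<dots> = (\<Sum>k\<le>8. \<Sum>l\<le>8. (if k = l then 1 else 0) * (x k * y l))"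
    by (intro sum.cong refl) (simp add: R)
  also have "\<dots> = (\<Sum>k\<le>8. x k * y k)"
    by (intro sum.cong refl) (simp add: if_distrib[of "\<lambda>z. z * _"] cong: if_cong)
  finally show ?thesis .
qed

lemma contraction_cong:
  assumes "\<And>i j. i \<le> 8 \<Longrightarrow> j \<le> 8 \<Longrightarrow> A i j = A' i j" "\<And>i j. i \<le> 8 \<Longrightarrow> j \<le> 8 \<Longrightarrow> B i j = B' i j"
    "\<And>i j. i \<le> 8 \<Longrightarrow> j \<le> 8 \<Longrightarrow> C i j = C' i j" "\<And>i j. i \<le> 8 \<Longrightarrow> j \<le> 8 \<Longrightarrow> D i j = D' i j"
  shows "contraction A B C D = contraction A' B' C' D'"
  unfolding contraction_def using assms by (intro sum.cong refl) simp

text \<open>Grouped in this way, the contraction only involves the inner products of columns, which an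
  orthogonal change of the row index preserves.\<close>

lemma contraction_by_columns:
  "contraction A B C D = (\<Sum>j\<le>8. \<Sum>j'\<le>8. (\<Sum>i\<le>8. A i j * B i j') * (\<Sum>i'\<le>8. C i' j * D i' j'))"
proof -
  have "contraction A B C D = (\<Sum>j\<le>8. \<Sum>i\<le>8. \<Sum>j'\<le>8. \<Sum>i'\<le>8. A i j * B i j' * (C i' j * D i' j'))"
    unfolding contraction_def mult.assoc
    by (subst sum.swap) (intro sum.cong refl sum.swap)
  also have "\<dots> = (\<Sum>j\<le>8. \<Sum>j'\<le>8. \<Sum>i\<le>8. \<Sum>i'\<le>8. A i j * B i j' * (C i' j * D i' j'))"
    by (intro sum.cong refl sum.swap)
  finally show ?thesis
    by (simp only: sum_product)
qed

text \<open>Exchanges the roles of rows and columns, so that invariance under a change of the row index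
  also gives invariance under a change of the column index.\<close>

lemma contraction_transpose:
  "contraction A B C D = contraction (\<lambda>i j. A j i) (\<lambda>i j. C j i) (\<lambda>i j. B j i) (\<lambda>i j. D j i)"
proof -
  have "contraction A B C D = (\<Sum>i\<le>8. \<Sum>i'\<le>8. \<Sum>j\<le>8. \<Sum>j'\<le>8. A i j * B i j' * C i' j * D i' j')"
    unfolding contraction_def by (intro sum.cong refl sum.swap)
  also have "\<dots> = (\<Sum>i\<le>8. \<Sum>i'\<le>8. (\<Sum>j\<le>8. A i j * C i' j) * (\<Sum>j'\<le>8. B i j' * D i' j'))"
    by (simp only: sum_product mult_ac)
  finally show ?thesis
    by (simp only: contraction_by_columns[of "\<lambda>i j. A j i"])
qed

lemma contraction_orthogonal:
  fixes R :: "nat \<Rightarrow> nat \<Rightarrow> real"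
  assumes R: "\<And>k l. k \<le> 8 \<Longrightarrow> l \<le> 8 \<Longrightarrow> (\<Sum>i\<le>8. R i k * R i l) = (if k = l then 1 else 0)"
  defines "T \<equiv> \<lambda>A i j. \<Sum>k\<le>8. \<Sum>l\<le>8. R i k * (R j l * A k l)"
  shows "contraction (T A) (T B) (T C) (T D) = contraction A B C D"
proof -
  define L where "L A i j = (\<Sum>k\<le>8. R i k * A k j)" for A :: "nat \<Rightarrow> nat \<Rightarrow> real" and i j
  have L: "contraction (L A) (L B) (L C) (L D) = contraction A B C D" for A B C D
    unfolding contraction_by_columns L_def by (simp add: orthogonal_inner_product[OF R])
  have T: "T A = L (\<lambda>k j. L (\<lambda>j k. A k j) j k)" for A
    by (simp add: T_def L_def fun_eq_iff sum_distrib_left)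
  show ?thesis
    unfolding T L
    by (subst (1 2) contraction_transpose) (rule L)
qed

section \<open>Linear combinations of the generators\<close>

text \<open>Coefficient vectors of combinations of the generators are functions of which only the values at
  \<open>0, \<dots>, 8\<close> matter; they form the Euclidean space \<open>\<real>\<^sup>9\<close> on which the spin group acts by rotations.\<close>

definition coeff_inner :: "(nat \<Rightarrow> real) \<Rightarrow> (nat \<Rightarrow> real) \<Rightarrow> real" where
  "coeff_inner a b = (\<Sum>i\<le>8. a i * b i)"

definition coeff_unit :: "nat \<Rightarrow> nat \<Rightarrow> real" where
  "coeff_unit i = (\<lambda>k. if k = i then 1 else 0)"

lemma coeff_inner_commute: "coeff_inner a b = coeff_inner b a"
  by (simp add: coeff_inner_def mult.commute)

lemma coeff_inner_linear:
  "coeff_inner (\<lambda>k. r * a k - s * b k) c = r * coeff_inner a c - s * coeff_inner b c"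
  "coeff_inner c (\<lambda>k. r * a k - s * b k) = r * coeff_inner c a - s * coeff_inner c b"
  "coeff_inner (\<lambda>k. a k - s * b k) c = coeff_inner a c - s * coeff_inner b c"
  "coeff_inner c (\<lambda>k. a k - s * b k) = coeff_inner c a - s * coeff_inner c b"
  "coeff_inner (\<lambda>k. a k - b k) c = coeff_inner a c - coeff_inner b c"
  "coeff_inner c (\<lambda>k. a k - b k) = coeff_inner c a - coeff_inner c b"
  "coeff_inner (\<lambda>k. r * a k) c = r * coeff_inner a c"
  "coeff_inner c (\<lambda>k. r * a k) = r * coeff_inner c a"
  by (simp_all add: coeff_inner_def sum_subtractf sum_distrib_left algebra_simps)

lemma coeff_inner_reflect:
  assumes "coeff_inner c c = 1"
  shows "coeff_inner (\<lambda>k. 2 * coeff_inner a c * c k - 1 * a k) (\<lambda>k. 2 * coeff_inner b c * c k - 1 * b k) = coeff_inner a b"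
  unfolding coeff_inner_linear assms by (simp add: coeff_inner_commute[of c] algebra_simps)

lemma coeff_inner_coeff_unit [simp]: "i \<le> 8 \<Longrightarrow> coeff_inner a (coeff_unit i) = a i" "i \<le> 8 \<Longrightarrow> coeff_inner (coeff_unit i) a = a i"
  by (simp_all add: coeff_inner_def coeff_unit_def if_distrib[of "\<lambda>z. _ * z"] if_distrib[of "\<lambda>z. z * _"] cong: if_cong)

lemma I_comb_coeff_unit: "i \<le> 8 \<Longrightarrow> I_comb (coeff_unit i) = I_op i"
  by (simp add: I_comb_def coeff_unit_def fun_eq_iff if_distrib[of "\<lambda>z. z *\<^sub>R _"] cong: if_cong)

lemma I_comb_cong: "(\<And>k. k \<le> 8 \<Longrightarrow> a k = b k) \<Longrightarrow> I_comb a = I_comb b"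
  by (simp add: I_comb_def fun_eq_iff)

lemma linear_I_comb: "linear (I_comb a)"
  unfolding I_comb_def by (intro linear_compose_sum ballI linear_compose_scale_right linear_I_op)

lemma I_comb_symmetric: "I_comb a x \<bullet> y = x \<bullet> I_comb a y"
  by (simp add: I_comb_def inner_sum_left inner_sum_right I_op_symmetric)

lemma I_comb_lincomb: "I_comb (\<lambda>k. r * a k - s * b k) x = r *\<^sub>R I_comb a x - s *\<^sub>R I_comb b x"
  by (simp add: I_comb_def scaleR_sum_right sum_subtractf algebra_simps)

lemma I_comb_I_comb: "I_comb a (I_comb b x) = (\<Sum>i\<le>8. \<Sum>j\<le>8. (a i * b j) *\<^sub>R I_op i (I_op j x))"
  by (simp add: I_comb_def I_op_linear_simps scaleR_sum_right)

lemma I_comb_Clifford: "I_comb a (I_comb b x) + I_comb b (I_comb a x) = (2 * coeff_inner a b) *\<^sub>R x"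
proof -
  have "I_comb b (I_comb a x) = (\<Sum>i\<le>8. \<Sum>j\<le>8. (a i * b j) *\<^sub>R I_op j (I_op i x))"
    by (subst sum.swap) (simp add: I_comb_I_comb mult.commute)
  then have "I_comb a (I_comb b x) + I_comb b (I_comb a x)
      = (\<Sum>i\<le>8. \<Sum>j\<le>8. (a i * b j) *\<^sub>R (I_op i (I_op j x) + I_op j (I_op i x)))"
    by (simp add: I_comb_I_comb sum.distrib scaleR_add_right)
  also have "\<dots> = (\<Sum>i\<le>8. \<Sum>j\<le>8. (a i * b j) *\<^sub>R ((if i = j then 2 else 0) *\<^sub>R x))"
    by (intro sum.cong refl) (simp only: I_op_Clifford atMost_iff)
  also have "\<dots> = (\<Sum>i\<le>8. \<Sum>j\<le>8. if j = i then (2 * (a i * b i)) *\<^sub>R x else 0)"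
    by (intro sum.cong refl) auto
  also have "\<dots> = (2 * coeff_inner a b) *\<^sub>R x"
    by (simp add: coeff_inner_def scaleR_sum_left sum_distrib_left)
  finally show ?thesis .
qed

lemma I_comb_square: "coeff_inner a a = 1 \<Longrightarrow> I_comb a (I_comb a x) = x"
  using I_comb_Clifford[of a a x] by (simp flip: scaleR_2)

text \<open>Conjugation by a unit vector of \<open>\<real>\<^sup>9\<close> is the negative of the reflection in its orthogonal hyperplane.
  The factor 1 makes the result an instance of \<open>I_comb_lincomb\<close>.\<close>

lemma I_comb_reflect:
  assumes "coeff_inner c c = 1"
  shows "I_comb c (I_comb b (I_comb c x)) = I_comb (\<lambda>k. 2 * coeff_inner b c * c k - 1 * b k) x"
proof -
  have "I_comb c (I_comb b (I_comb c x)) = (2 * coeff_inner c b) *\<^sub>R I_comb c x - I_comb b (I_comb c (I_comb c x))"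
    using I_comb_Clifford[of c b "I_comb c x"] by (simp add: algebra_simps)
  then show ?thesis
    by (simp only: I_comb_square[OF assms] I_comb_lincomb coeff_inner_commute[of b c] scaleR_one)
qed

section \<open>Invariance of the canonical form\<close>

text \<open>The bilinear forms \<open>\<langle>X, I\<^sub>i I\<^sub>j Y\<rangle>\<close> transform by \<open>R\<close> in both indices. For \<open>i = j\<close> such a form is the scalar
  product, whereas \<^const>\<open>varpi\<close> vanishes; the discrepancy is \<open>\<delta>\<^sub>i\<^sub>j \<langle>X, Y\<rangle>\<close> on both sides because
  \<open>R\<close> is orthogonal.\<close>

lemma varpi_I_comb:
  assumes c: "coeff_inner c c = 1" and ij: "i \<le> 8" "j \<le> 8"
  defines "R \<equiv> \<lambda>i k. 2 * c i * c k - 1 * coeff_unit i k"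
  shows "varpi i j (\<lambda>k. I_comb c (v k)) = (\<Sum>k\<le>8. \<Sum>l\<le>8. R i k * (R j l * varpi k l v))"
proof -
  have conj: "I_comb c (I_op i (I_comb c x)) = I_comb (R i) x" if "i \<le> 8" for i x
    using I_comb_reflect[OF c, of "coeff_unit i" x] that by (simp add: R_def I_comb_coeff_unit)
  have RR: "coeff_inner (R i) (R j) = (if i = j then 1 else 0)" if "i \<le> 8" "j \<le> 8" for i j
    using that coeff_inner_reflect[OF c, of "coeff_unit i" "coeff_unit j"] by (simp add: R_def) (simp add: coeff_unit_def)
  have split: "x \<bullet> I_op k (I_op l y) = varpi k l v + (if k = l then x \<bullet> y else 0)"
    if "k \<le> 8" "x = v 0" "y = v 1" for k l x y
    using that by (simp add: varpi_def)
  have "I_comb c (v 0) \<bullet> I_op i (I_op j (I_comb c (v 1)))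
      = v 0 \<bullet> I_comb c (I_op i (I_comb c (I_comb c (I_op j (I_comb c (v 1))))))"
    by (simp add: I_comb_symmetric I_comb_square[OF c])
  also have "\<dots> = v 0 \<bullet> I_comb (R i) (I_comb (R j) (v 1))"
    by (simp only: conj ij)
  also have "\<dots> = (\<Sum>k\<le>8. \<Sum>l\<le>8. R i k * R j l * (v 0 \<bullet> I_op k (I_op l (v 1))))"
    by (simp add: I_comb_I_comb inner_sum_right)
  also have "\<dots> = (\<Sum>k\<le>8. \<Sum>l\<le>8. R i k * (R j l * varpi k l v)
        + (if l = k then R i k * R j k * (v 0 \<bullet> v 1) else 0))"
    by (intro sum.cong refl) (auto simp: split algebra_simps)
  also have "\<dots> = (\<Sum>k\<le>8. \<Sum>l\<le>8. R i k * (R j l * varpi k l v)) + coeff_inner (R i) (R j) * (v 0 \<bullet> v 1)"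
    by (simp add: sum.distrib coeff_inner_def sum_distrib_right)
  finally have *: "I_comb c (v 0) \<bullet> I_op i (I_op j (I_comb c (v 1)))
      = (\<Sum>k\<le>8. \<Sum>l\<le>8. R i k * (R j l * varpi k l v)) + (if i = j then v 0 \<bullet> v 1 else 0)"
    by (simp add: RR ij)
  show ?thesis
  proof (cases "i = j")
    case True
    then have "I_comb c (v 0) \<bullet> I_op i (I_op j (I_comb c (v 1))) = v 0 \<bullet> v 1"
      using ij by (simp add: I_comb_symmetric I_comb_square[OF c])
    with * True show ?thesis
      by (simp add: varpi_def)
  next
    case False
    with * show ?thesis
      by (simp add: varpi_def)
  qed
qed

text \<open>Invariance under one operator \<open>\<Sum> c\<^sub>i I\<^sub>i\<close>: the four factors of the form are transformed by the same
  orthogonal matrix and all their indices are contracted.\<close>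

lemma Omega8_I_comb:
  assumes c: "coeff_inner c c = 1"
  shows "Omega8 (\<lambda>k. I_comb c (v k)) = Omega8 v"
proof -
  define R where "R = (\<lambda>i k. 2 * c i * c k - 1 * coeff_unit i k)"
  have R: "(\<Sum>i\<le>8. R i k * R i l) = (if k = l then 1 else 0)" if "k \<le> 8" "l \<le> 8" for k l
  proof -
    have "R i k = R k i" for i k
      by (simp add: R_def coeff_unit_def)
    then have "(\<Sum>i\<le>8. R i k * R i l) = coeff_inner (R k) (R l)"
      by (simp add: coeff_inner_def)
    also have "\<dots> = (if k = l then 1 else 0)"
      using that coeff_inner_reflect[OF c, of "coeff_unit k" "coeff_unit l"] by (simp add: R_def) (simp add: coeff_unit_def)
    finally show ?thesis .
  qed
  define T where "T A i j = (\<Sum>k\<le>8. \<Sum>l\<le>8. R i k * (R j l * A k l))" for A i j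
  have "four_fold varpi (\<lambda>k. I_comb c (w k)) = four_fold varpi w" for w
  proof -
    have "four_fold varpi (\<lambda>k. I_comb c (w k)) =
      contraction (T (\<lambda>i j. varpi i j w)) (T (\<lambda>i j. varpi i j (\<lambda>k. w (2 + k))))
        (T (\<lambda>i j. varpi i j (\<lambda>k. w (4 + k)))) (T (\<lambda>i j. varpi i j (\<lambda>k. w (6 + k))))"
      unfolding four_fold_def by (intro contraction_cong; simp only: varpi_I_comb[OF c] R_def T_def)
    also have "\<dots> = four_fold varpi w"
      unfolding four_fold_def T_def by (rule contraction_orthogonal[OF R])
    finally show ?thesis .
  qed
  then show ?thesis
    by (simp add: Omega8_eq_Alt Alt_def)
qed

section \<open>Multilinearity\<close>

definition multilinear :: "nat \<Rightarrow> 'a::real_vector form \<Rightarrow> bool" where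
  "multilinear n F \<longleftrightarrow> (\<forall>k<n. \<forall>v. linear (\<lambda>x. F (v(k := x))))"

lemma multilinear_Alt:
  assumes "multilinear n F"
  shows "multilinear n (Alt n F)"
  unfolding multilinear_def Alt_def
proof (intro allI impI linear_compose_sum ballI)
  fix k \<sigma> and v :: "nat \<Rightarrow> 'a" assume k: "k < n" and "\<sigma> \<in> {\<sigma>. \<sigma> permutes {..<n}}"
  then have \<sigma>: "\<sigma> permutes {..<n}" by simp
  have "(\<lambda>i. (v(k := x)) (\<sigma> i)) = (\<lambda>i. v (\<sigma> i))(inv_into UNIV \<sigma> k := x)" for x
    by (auto simp: fun_eq_iff permutes_inverses[OF \<sigma>])
  moreover have "inv_into UNIV \<sigma> k < n"
    using permutes_in_image[OF permutes_inv[OF \<sigma>]] k by simp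
  ultimately show "linear (\<lambda>x. of_int (sign \<sigma>) * F (\<lambda>i. (v(k := x)) (\<sigma> i)))"
    using assms linear_compose_scale_right[of "\<lambda>x. F ((\<lambda>i. v (\<sigma> i))(inv_into UNIV \<sigma> k := x))" "of_int (sign \<sigma>)"]
    by (simp add: multilinear_def del: fun_upd_apply)
qed

lemma multilinear_four_fold: "multilinear 8 (four_fold varpi)"
  unfolding multilinear_def four_fold_def contraction_def
proof (intro allI impI linear_compose_sum ballI)
  fix k :: nat and v :: "nat \<Rightarrow> oct2" and i j i' j' :: nat
  assume "k < 8"
  then consider "k = 0" | "k = 1" | "k = 2" | "k = 3" | "k = 4" | "k = 5" | "k = 6" | "k = 7"
    by linarith
  then show "linear (\<lambda>x. varpi i j (v(k := x)) * varpi i j' (\<lambda>m. (v(k := x)) (2 + m)) *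
      varpi i' j (\<lambda>m. (v(k := x)) (4 + m)) * varpi i' j' (\<lambda>m. (v(k := x)) (6 + m)))"
    by cases (rule linearI; simp add: varpi_def I_op_linear_simps inner_add_left inner_add_right algebra_simps)+
qed

lemma multilinear_Omega8: "multilinear 8 Omega8"
  unfolding multilinear_def
proof (intro allI impI)
  fix k :: nat and v assume "k < 8"
  then have "linear (\<lambda>x. Alt 8 (four_fold varpi) (v(k := x)))"
    using multilinear_Alt[OF multilinear_four_fold] by (simp add: multilinear_def)
  from linear_compose_scale_right[OF this, of "1 / 16"]
  show "linear (\<lambda>x. Omega8 (v(k := x)))"
    by (simp add: Omega8_eq_Alt)
qed

lemma linear_Omega8: "k < 8 \<Longrightarrow> linear (\<lambda>x. Omega8 (v(k := x)))"
  using multilinear_Omega8 by (simp add: multilinear_def)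

lemma varpi_cong: "v 0 = w 0 \<Longrightarrow> v 1 = w 1 \<Longrightarrow> varpi i j v = varpi i j w"
  by (simp add: varpi_def)

lemma Omega8_cong:
  assumes "\<And>k. k < 8 \<Longrightarrow> v k = w k"
  shows "Omega8 v = Omega8 w"
proof -
  have "four_fold varpi (\<lambda>i. v (\<sigma> i)) = four_fold varpi (\<lambda>i. w (\<sigma> i))" if "\<sigma> permutes {..<8}" for \<sigma>
  proof -
    have "v (\<sigma> i) = w (\<sigma> i)" if "i < 8" for i
      using assms permutes_in_image[OF \<open>\<sigma> permutes _\<close>] that by simp
    then show ?thesis
      unfolding four_fold_def by (intro contraction_cong varpi_cong) simp_all
  qed
  then show ?thesis
    by (simp add: Omega8_eq_Alt Alt_def)
qed

text \<open>The product rule at \<open>t = 0\<close>, by induction on the number of entries that move along a circle.\<close>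

lemma DERIV_multilinear:
  assumes F: "multilinear n F" and m: "m \<le> n"
  shows "((\<lambda>t. F (\<lambda>k. if k < m then cos t *\<^sub>R v k + sin t *\<^sub>R w k else v k))
           has_real_derivative (\<Sum>k<m. F (v(k := w k)))) (at 0)"
  using m
proof (induction m arbitrary: v)
  case 0
  show ?case by simp
next
  case (Suc m)
  define A where "A v t = (\<lambda>k. if k < m then cos t *\<^sub>R v k + sin t *\<^sub>R w k else v k)" for v t
  have step: "F (\<lambda>k. if k < Suc m then cos t *\<^sub>R v k + sin t *\<^sub>R w k else v k)
      = cos t * F (A v t) + sin t * F (A (v(m := w m)) t)" for t
  proof -
    have lin: "linear (\<lambda>x. F ((A v t)(m := x)))"
      using F Suc.prems by (simp add: multilinear_def)
    have "(\<lambda>k. if k < Suc m then cos t *\<^sub>R v k + sin t *\<^sub>R w k else v k)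
        = (A v t)(m := cos t *\<^sub>R v m + sin t *\<^sub>R w m)"
      by (auto simp: A_def fun_eq_iff)
    moreover have "(A v t)(m := v m) = A v t" "(A v t)(m := w m) = A (v(m := w m)) t"
      by (auto simp: A_def fun_eq_iff)
    ultimately show ?thesis
      using linear_add[OF lin] linear_scale[OF lin] by simp
  qed
  have D: "((\<lambda>t. F (A v t)) has_real_derivative (\<Sum>k<m. F (v(k := w k)))) (at 0)" for v
    unfolding A_def by (rule Suc.IH) (use Suc.prems in simp)
  have A0: "A v 0 = v" for v
    by (simp add: A_def fun_eq_iff)
  show ?case
    unfolding step
    by (rule derivative_eq_intros D refl)+ (simp add: A0 del: fun_upd_apply)
qed

section \<open>The infinitesimal stabilizer\<close>

definition stabilizes_Omega8 :: "(oct2 \<Rightarrow> oct2) \<Rightarrow> bool" where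
  "stabilizes_Omega8 g \<longleftrightarrow> linear g \<and> (\<forall>v. Omega8 (\<lambda>k. g (v k)) = Omega8 v)"

text \<open>The Lie algebra of the stabilizer: the operators that annihilate the form as derivations.\<close>

definition stab_algebra :: "(oct2 \<Rightarrow> oct2) set" where
  "stab_algebra = {X. linear X \<and> (\<forall>v. (\<Sum>k<8. Omega8 (v(k := X (v k)))) = 0)}"

lemma stab_algebra_linear: "X \<in> stab_algebra \<Longrightarrow> linear X"
  by (simp add: stab_algebra_def)

lemma stab_algebraD: "X \<in> stab_algebra \<Longrightarrow> (\<Sum>k<8. Omega8 (v(k := X (v k)))) = 0"
  by (simp add: stab_algebra_def)

lemma Omega8_slot_linear:
  assumes "k < 8"
  shows "Omega8 (v(k := x + y)) = Omega8 (v(k := x)) + Omega8 (v(k := y))"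
    "Omega8 (v(k := c *\<^sub>R x)) = c * Omega8 (v(k := x))"
    "Omega8 (v(k := x - y)) = Omega8 (v(k := x)) - Omega8 (v(k := y))"
    "Omega8 (v(k := - x)) = - Omega8 (v(k := x))"
    "Omega8 (v(k := 0)) = 0"
  using linear_add[OF linear_Omega8[OF assms]] linear_scale[OF linear_Omega8[OF assms]]
    linear_diff[OF linear_Omega8[OF assms]] linear_neg[OF linear_Omega8[OF assms]]
    linear_0[OF linear_Omega8[OF assms]]
  by (simp_all del: fun_upd_apply)

lemma stab_algebra_add:
  assumes "X \<in> stab_algebra" "Y \<in> stab_algebra"
  shows "(\<lambda>x. X x + Y x) \<in> stab_algebra"
  using assms by (simp add: stab_algebra_def linear_compose_add Omega8_slot_linear sum.distrib)

lemma stab_algebra_scale: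
  assumes "X \<in> stab_algebra"
  shows "(\<lambda>x. c *\<^sub>R X x) \<in> stab_algebra"
  using assms by (simp add: stab_algebra_def linear_compose_scale_right Omega8_slot_linear flip: sum_distrib_left)

lemma stab_algebra_conj:
  assumes X: "X \<in> stab_algebra" and g: "stabilizes_Omega8 g" "linear g'"
    and inv: "\<And>x. g (g' x) = x"
  shows "(\<lambda>x. g (X (g' x))) \<in> stab_algebra"
proof -
  have "linear (\<lambda>x. g (X (g' x)))"
    using linear_compose[OF linear_compose[OF g(2) stab_algebra_linear[OF X]], of g] g(1)
    by (simp add: stabilizes_Omega8_def o_def)
  moreover have "(\<Sum>k<8. Omega8 (v(k := g (X (g' (v k)))))) = 0" for v
  proof -
    define w where "w k = g' (v k)" for k
    have "v(k := g (X (g' (v k)))) = (\<lambda>i. g ((w(k := X (w k))) i))" for k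
      by (auto simp: w_def inv fun_eq_iff)
    then have "(\<Sum>k<8. Omega8 (v(k := g (X (g' (v k)))))) = (\<Sum>k<8. Omega8 (w(k := X (w k))))"
      using g(1) by (simp add: stabilizes_Omega8_def del: fun_upd_apply)
    with X show ?thesis
      by (simp add: stab_algebraD)
  qed
  ultimately show ?thesis
    by (simp add: stab_algebra_def)
qed

text \<open>Applying the derivation of \<open>X\<close> and then that of \<open>Y\<close> produces terms with two changed entries, which
  are symmetric in \<open>X\<close> and \<open>Y\<close>, and terms with one entry changed by a composition. Since both
  totals vanish, the latter have the same sum for both orders.\<close>

lemma stab_algebra_bracket:
  assumes X: "X \<in> stab_algebra" and Y: "Y \<in> stab_algebra"
  shows "(\<lambda>x. X (Y x) - Y (X x)) \<in> stab_algebra"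
proof -
  note lX = stab_algebra_linear[OF X] and lY = stab_algebra_linear[OF Y]
  have "linear (\<lambda>x. X (Y x) - Y (X x))"
    using linear_compose_sub[OF linear_compose[OF lY lX] linear_compose[OF lX lY]] by (simp add: o_def)
  moreover have "(\<Sum>k<8. Omega8 (v(k := X (Y (v k)) - Y (X (v k))))) = 0" for v
  proof -
    let ?S = "\<lambda>X Y. \<Sum>k<8. \<Sum>l<8. if l = k then 0 else Omega8 (v(k := X (v k), l := Y (v l)))"
    have *: "(\<Sum>k<8. Omega8 (v(k := Y (X (v k))))) = - ?S X Y"
      if "Y \<in> stab_algebra" for X Y
    proof -
      have "0 = (\<Sum>k<8. \<Sum>l<8. Omega8 ((v(k := X (v k)))(l := Y ((v(k := X (v k))) l))))"
        by (simp only: stab_algebraD[OF that] sum.neutral_const)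
      also have "\<dots> = (\<Sum>k<8. \<Sum>l<8. (if l = k then Omega8 (v(k := Y (X (v k)))) else 0) +
          (if l = k then 0 else Omega8 (v(k := X (v k), l := Y (v l)))))"
        by (intro sum.cong refl) auto
      also have "\<dots> = (\<Sum>k<8. Omega8 (v(k := Y (X (v k))))) + ?S X Y"
        by (simp add: sum.distrib del: fun_upd_apply)
      finally show ?thesis by simp
    qed
    have "?S X Y = ?S Y X"
      by (subst sum.swap) (intro sum.cong refl, auto simp: fun_upd_twist)
    then show ?thesis
      using *[OF X, of Y] *[OF Y, of X] by (simp add: Omega8_slot_linear sum_subtractf del: fun_upd_apply)
  qed
  ultimately show ?thesis
    by (simp add: stab_algebra_def)
qed

lemma stabilizes_Omega8_comp: "stabilizes_Omega8 g \<Longrightarrow> stabilizes_Omega8 h \<Longrightarrow> stabilizes_Omega8 (g \<circ> h)"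
  by (simp add: stabilizes_Omega8_def linear_compose)

lemma stabilizes_Omega8_I_comb: "coeff_inner c c = 1 \<Longrightarrow> stabilizes_Omega8 (I_comb c)"
  by (simp add: stabilizes_Omega8_def linear_I_comb Omega8_I_comb)

lemma stabilizes_Omega8_I_op: "i \<le> 8 \<Longrightarrow> stabilizes_Omega8 (I_op i)"
  using stabilizes_Omega8_I_comb[of "coeff_unit i"] by (simp add: I_comb_coeff_unit) (simp add: coeff_unit_def)

text \<open>The rotations \<open>cos t + sin t I\<^sub>i I\<^sub>j = I\<^sub>i (cos t I\<^sub>i + sin t I\<^sub>j)\<close> preserve the form; their derivative
  at \<open>t = 0\<close> is \<open>I\<^sub>i I\<^sub>j\<close>.\<close>

lemma I_op_I_op_in_stab_algebra:
  assumes ij: "i \<le> 8" "j \<le> 8" "i \<noteq> j"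
  shows "(\<lambda>x. I_op i (I_op j x)) \<in> stab_algebra"
proof -
  have "(\<Sum>k<8. Omega8 (v(k := I_op i (I_op j (v k))))) = 0" for v
  proof -
    define w where "w k = I_op i (I_op j (v k))" for k
    have const: "Omega8 (\<lambda>k. if k < 8 then cos t *\<^sub>R v k + sin t *\<^sub>R w k else v k) = Omega8 v" for t
    proof -
      define c where "c = (\<lambda>k. cos t * coeff_unit i k - (- sin t) * coeff_unit j k)"
      have "coeff_inner c c = (cos t)\<^sup>2 + (sin t)\<^sup>2"
        unfolding c_def coeff_inner_linear using ij by (simp add: power2_eq_square) (simp add: coeff_unit_def)
      then have "stabilizes_Omega8 (I_op i \<circ> I_comb c)"
        using ij by (intro stabilizes_Omega8_comp stabilizes_Omega8_I_op stabilizes_Omega8_I_comb) simp_all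
      then have inv: "Omega8 (\<lambda>k. (I_op i \<circ> I_comb c) (v k)) = Omega8 v"
        by (simp only: stabilizes_Omega8_def)
      have eq: "(I_op i \<circ> I_comb c) (v k) = cos t *\<^sub>R v k + sin t *\<^sub>R w k" for k
        unfolding o_apply c_def I_comb_lincomb I_comb_coeff_unit[OF ij(1)] I_comb_coeff_unit[OF ij(2)] w_def
        using ij by (simp add: I_op_linear_simps)
      have "Omega8 (\<lambda>k. cos t *\<^sub>R v k + sin t *\<^sub>R w k) = Omega8 v"
        using inv unfolding eq .
      then show ?thesis
        by (subst Omega8_cong[where w = "\<lambda>k. cos t *\<^sub>R v k + sin t *\<^sub>R w k"]) auto
    qed
    have "((\<lambda>t. Omega8 v) has_real_derivative (\<Sum>k<8. Omega8 (v(k := w k)))) (at 0)"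
      using DERIV_multilinear[OF multilinear_Omega8 order.refl, of v w] unfolding const .
    then show ?thesis
      unfolding w_def using DERIV_unique[OF _ DERIV_const] by blast
  qed
  then show ?thesis
    using linear_compose[OF linear_I_op linear_I_op] by (simp add: stab_algebra_def o_def)
qed

section \<open>The spin group\<close>

lemma foldr_comp_append: "foldr (\<circ>) (fs @ gs) id = foldr (\<circ>) fs id \<circ> foldr (\<circ>) gs id"
  by (induction fs) (auto simp: o_assoc)

text \<open>A product of odd length becomes one of even length when the trivial product \<open>I\<^sub>0 \<dots> I\<^sub>8\<close> is appended.\<close>

lemma rho_Spin9_altdef:
  "rho_Spin9 = {foldr (\<circ>) (map I_comb as) id | as. \<forall>a\<in>set as. coeff_inner a a = 1}"
proof -
  have coeff_inner: "(\<Sum>i\<le>8. (a i)\<^sup>2) = coeff_inner a a" for a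
    by (simp add: coeff_inner_def power2_eq_square)
  \<comment> \<open>The nine standard vectors, whose product is the identity.\<close>
  define vol where "vol = map coeff_unit [0..<9]"
  have "map I_comb vol = map I_op [0..<9]"
    unfolding vol_def map_map by (intro map_cong) (auto simp: I_comb_coeff_unit)
  then have vol: "foldr (\<circ>) (map I_comb vol) id = id"
    using I_word_volume by (simp only: I_word_def) (simp add: fun_eq_iff)
  have unit: "coeff_inner a a = 1" if "a \<in> set vol" for a
    using that unfolding vol_def by (auto simp: less_Suc_eq_le) (auto simp: coeff_unit_def)
  have "foldr (\<circ>) (map I_comb as) id \<in> rho_Spin9" if as: "\<forall>a\<in>set as. coeff_inner a a = 1" for as
  proof (cases "even (length as)")
    case True
    with as show ?thesis
      by (auto simp: rho_Spin9_def coeff_inner)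
  next
    case False
    then have "even (length (as @ vol))"
      by (simp add: vol_def)
    moreover have "foldr (\<circ>) (map I_comb as) id = foldr (\<circ>) (map I_comb (as @ vol)) id"
      by (simp only: map_append foldr_comp_append vol comp_id)
    moreover have "\<forall>a\<in>set (as @ vol). coeff_inner a a = 1"
      using as unit by auto
    ultimately show ?thesis
      unfolding rho_Spin9_def coeff_inner by blast
  qed
  then show ?thesis
    by (auto simp: rho_Spin9_def coeff_inner)
qed

lemma rho_Spin9_id: "id \<in> rho_Spin9"
  unfolding rho_Spin9_altdef by (rule CollectI, rule exI[of _ "[]"]) simp

lemma rho_Spin9_I_comb:
  assumes "coeff_inner a a = 1" "k \<in> rho_Spin9"
  shows "I_comb a \<circ> k \<in> rho_Spin9" "k \<circ> I_comb a \<in> rho_Spin9"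
proof -
  obtain as where as: "k = foldr (\<circ>) (map I_comb as) id" "\<forall>a\<in>set as. coeff_inner a a = 1"
    using assms(2) by (auto simp: rho_Spin9_altdef)
  show "I_comb a \<circ> k \<in> rho_Spin9"
    unfolding rho_Spin9_altdef using as assms(1) by (intro CollectI exI[of _ "a # as"]) auto
  have "k \<circ> I_comb a = foldr (\<circ>) (map I_comb (as @ [a])) id"
    by (simp only: map_append foldr_comp_append as) simp
  then show "k \<circ> I_comb a \<in> rho_Spin9"
    unfolding rho_Spin9_altdef using as assms(1) by (intro CollectI exI[of _ "as @ [a]"]) auto
qed

lemma rho_Spin9_induct [consumes 1, case_names id I_comb]:
  assumes "k \<in> rho_Spin9" and "P id"
    and "\<And>a k. coeff_inner a a = 1 \<Longrightarrow> k \<in> rho_Spin9 \<Longrightarrow> P k \<Longrightarrow> P (I_comb a \<circ> k)"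
  shows "P k"
proof -
  obtain as where as: "k = foldr (\<circ>) (map I_comb as) id" "\<forall>a\<in>set as. coeff_inner a a = 1"
    using assms(1) by (auto simp: rho_Spin9_altdef)
  have "foldr (\<circ>) (map I_comb as) id \<in> rho_Spin9 \<and> P (foldr (\<circ>) (map I_comb as) id)"
    using as(2) by (induction as) (simp_all add: assms rho_Spin9_id rho_Spin9_I_comb)
  with as show ?thesis by simp
qed

lemma stabilizes_Omega8_rho_Spin9: "k \<in> rho_Spin9 \<Longrightarrow> stabilizes_Omega8 k"
proof (induction rule: rho_Spin9_induct)
  case id
  show ?case by (simp add: stabilizes_Omega8_def linear_iff)
qed (intro stabilizes_Omega8_comp stabilizes_Omega8_I_comb)

lemma rho_Spin9_inverse:
  assumes "k \<in> rho_Spin9"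
  obtains k' where "k' \<in> rho_Spin9" "k' \<circ> k = id" "k \<circ> k' = id"
proof -
  from assms have "\<exists>k'\<in>rho_Spin9. k' \<circ> k = id \<and> k \<circ> k' = id"
  proof (induction rule: rho_Spin9_induct)
    case id
    show ?case by (rule bexI[OF _ rho_Spin9_id]) (simp only: comp_id)
  next
    case (I_comb a k)
    then obtain k' where k': "k' \<in> rho_Spin9" "k' \<circ> k = id" "k \<circ> k' = id" by blast
    have "(k' \<circ> I_comb a) \<circ> (I_comb a \<circ> k) = id" "(I_comb a \<circ> k) \<circ> (k' \<circ> I_comb a) = id"
      using k'(2,3) by (simp_all add: fun_eq_iff I_comb_square[OF I_comb(1)])
    with rho_Spin9_I_comb(2)[OF I_comb(1) k'(1)] show ?case by blast
  qed
  with that show thesis by blast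
qed

text \<open>Orthonormal vectors are moved to the standard ones by successive reflections, each of which
  leaves the vectors that are already in place fixed. Conjugation realizes a reflection only up to
  sign, and \<open>s\<close> collects these signs.\<close>

lemma rho_Spin9_frame:
  assumes orth: "\<And>i j. i < n \<Longrightarrow> j < n \<Longrightarrow> coeff_inner (a i) (a j) = (if i = j then 1 else 0)"
    and mn: "m \<le> n" "n \<le> 9"
  shows "\<exists>k\<in>rho_Spin9. \<exists>s\<in>{1, - 1}. \<exists>b.
    (\<forall>i<n. \<forall>j<n. coeff_inner (b i) (b j) = (if i = j then 1 else 0)) \<and>
    (\<forall>i<m. \<forall>p\<le>8. b i p = coeff_unit i p) \<and>
    (\<forall>i<n. \<forall>x. k (I_comb (a i) x) = s *\<^sub>R I_comb (b i) (k x))"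
  using mn(1)
proof (induction m)
  case 0
  show ?case
    by (rule bexI[OF _ rho_Spin9_id], rule bexI[of _ 1], rule exI[of _ a]) (auto simp: orth)
next
  case (Suc m)
  then obtain k s b where k: "k \<in> rho_Spin9" and s: "s \<in> {1, - 1}"
    and b: "\<And>i j. i < n \<Longrightarrow> j < n \<Longrightarrow> coeff_inner (b i) (b j) = (if i = j then 1 else 0)"
    and bm: "\<And>i p. i < m \<Longrightarrow> p \<le> 8 \<Longrightarrow> b i p = coeff_unit i p"
    and kb: "\<And>i x. i < n \<Longrightarrow> k (I_comb (a i) x) = s *\<^sub>R I_comb (b i) (k x)"
    by (metis Suc_leD)
  have m: "m < n" "m \<le> 8"
    using Suc.prems mn by auto
  define d where "d = (\<lambda>p. b m p - coeff_unit m p)"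
  have dd: "coeff_inner d d = 2 * (1 - b m m)"
    unfolding d_def coeff_inner_linear using m by (simp add: b) (simp add: coeff_unit_def)
  show ?case
  proof (cases "coeff_inner d d = 0")
    case True
    then have "\<forall>p\<le>8. d p = 0"
      by (simp add: coeff_inner_def sum_nonneg_eq_0_iff)
    then have "b i p = coeff_unit i p" if "i < Suc m" "p \<le> 8" for i p
      using that bm by (auto simp: less_Suc_eq d_def)
    with k s b kb show ?thesis by blast
  next
    case False
    have "coeff_inner d d \<ge> 0"
      by (simp add: coeff_inner_def sum_nonneg)
    with False have pos: "coeff_inner d d > 0" by simp
    define r where "r = 1 / sqrt (coeff_inner d d)"
    have r: "r * r * coeff_inner d d = 1"
      using pos by (simp add: r_def flip: real_sqrt_mult)
    define c where "c = (\<lambda>p. r * d p)"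
    have c: "coeff_inner c c = 1"
      unfolding c_def coeff_inner_linear using r by (simp add: mult_ac)
    define R where "R x = (\<lambda>p. 2 * coeff_inner x c * c p - 1 * x p)" for x
    \<comment> \<open>The reflection itself, without the sign that comes from conjugation.\<close>
    define b' where "b' i = (\<lambda>p. - R (b i) p)" for i
    have b'_eq: "b' i p = b i p - 2 * coeff_inner (b i) d / coeff_inner d d * d p" for i p
    proof -
      have "coeff_inner (b i) c * c p = r * r * (coeff_inner (b i) d * d p)"
        unfolding c_def coeff_inner_linear by simp
      moreover have "r * r = 1 / coeff_inner d d"
        using r pos by (simp add: field_simps)
      ultimately show ?thesis
        by (simp add: b'_def R_def)
    qed
    have "coeff_inner (b' i) (b' j) = coeff_inner (R (b i)) (R (b j))" for i j
      by (simp add: b'_def coeff_inner_def)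
    then have "coeff_inner (b' i) (b' j) = coeff_inner (b i) (b j)" for i j
      by (simp only: R_def coeff_inner_reflect[OF c])
    moreover have "b' i p = coeff_unit i p" if "i < Suc m" "p \<le> 8" for i p
    proof (cases "i = m")
      case True
      have "coeff_inner (b m) d = 1 - b m m"
        unfolding d_def coeff_inner_linear using m by (simp add: b)
      then have "2 * coeff_inner (b m) d / coeff_inner d d = 1"
        using dd pos by simp
      then show ?thesis
        unfolding b'_eq True by (simp add: d_def)
    next
      case False
      with that have i: "i < m" by simp
      have "coeff_inner (b i) d = 0"
        unfolding d_def coeff_inner_linear using m i by (simp add: b bm) (simp add: coeff_unit_def)
      then show ?thesis
        unfolding b'_eq using bm[OF i that(2)] by simp
    qed
    moreover have "(I_comb c \<circ> k) (I_comb (a i) x) = (- s) *\<^sub>R I_comb (b' i) ((I_comb c \<circ> k) x)"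
      if "i < n" for i x
    proof -
      have "I_comb c (I_comb (b i) (k x)) = I_comb c (I_comb (b i) (I_comb c (I_comb c (k x))))"
        by (simp add: I_comb_square[OF c])
      also have "\<dots> = I_comb (R (b i)) (I_comb c (k x))"
        by (simp only: I_comb_reflect[OF c] R_def)
      also have "\<dots> = - I_comb (b' i) (I_comb c (k x))"
        by (simp add: I_comb_def b'_def sum_negf)
      finally show ?thesis
        by (simp add: kb[OF that] linear_scale[OF linear_I_comb])
    qed
    moreover have "I_comb c \<circ> k \<in> rho_Spin9" "- s \<in> {1, - 1}"
      using rho_Spin9_I_comb(1)[OF c k] s by auto
    ultimately show ?thesis
      using b by (intro bexI[of _ "I_comb c \<circ> k"] bexI[of _ "- s"] exI[of _ b']) auto
  qed
qed

lemma rho_Spin9_frame_to_basis: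
  assumes orth: "\<And>i j. i < n \<Longrightarrow> j < n \<Longrightarrow> coeff_inner (a i) (a j) = (if i = j then 1 else 0)"
    and n: "n \<le> 9"
  obtains k s where "k \<in> rho_Spin9" "s \<in> {1, - 1}"
    "\<And>i x. i < n \<Longrightarrow> k (I_comb (a i) x) = s *\<^sub>R I_op i (k x)"
proof -
  obtain k s b where k: "k \<in> rho_Spin9" "s \<in> {1, - 1}"
    and bkb: "\<forall>i<n. \<forall>p\<le>8. b i p = coeff_unit i p"
      "\<forall>i<n. \<forall>x. k (I_comb (a i) x) = s *\<^sub>R I_comb (b i) (k x)"
    using rho_Spin9_frame[OF orth order.refl n] by blast
  then have b: "\<And>i p. i < n \<Longrightarrow> p \<le> 8 \<Longrightarrow> b i p = coeff_unit i p"
    and kb: "\<And>i x. i < n \<Longrightarrow> k (I_comb (a i) x) = s *\<^sub>R I_comb (b i) (k x)"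
    by auto
  have "I_comb (b i) = I_op i" if "i < n" for i
    using I_comb_cong[OF b[OF that]] that n by (simp add: I_comb_coeff_unit)
  with k kb that show thesis by simp
qed

section \<open>The canonical form on an octonionic line\<close>

lemma oct_cnj_cnj [simp]: "oct_cnj (oct_cnj x) = x"
  by (simp add: oct_defs case_prod_beta prod_eq_iff)

lemma oct_cnj_mult: "oct_cnj (oct_mult x y) = oct_mult (oct_cnj y) (oct_cnj x)"
  by (simp add: oct_defs case_prod_beta prod_eq_iff algebra_simps)

lemma oct_inner_cnj: "oct_cnj x \<bullet> oct_cnj y = x \<bullet> y"
  by (simp add: oct_defs case_prod_beta inner_prod_def inner_complex_def)

lemma oct_mult_left_polarized:
  "oct_mult u (oct_mult (oct_cnj v) x) + oct_mult v (oct_mult (oct_cnj u) x) = (2 * (u \<bullet> v)) *\<^sub>R x"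
  using oct_mult_polarized(1)[of u x v] by (simp add: oct_cnj_mult)

lemma oct_inner_left_mult: "oct_mult (oct_cnj u) x \<bullet> y = x \<bullet> oct_mult u y"
  by (simp add: oct_defs inner_complex_def inner_prod_def case_prod_beta, simp add: algebra_simps)

text \<open>Left multiplications by distinct units and by their conjugates alternate like Clifford generators;
  this is the triality that turns a line \<open>O \<times> 0\<close> into a space of Clifford generators.\<close>

lemma oct_unit_swap:
  assumes "a < 8" "b < 8" "a \<noteq> b"
  shows "oct_mult (oct_unit a) (oct_mult (oct_cnj (oct_unit b)) x)
      = - oct_mult (oct_unit b) (oct_mult (oct_cnj (oct_unit a)) x)"
    "oct_mult (oct_cnj (oct_unit a)) (oct_mult (oct_unit b) x)
      = - oct_mult (oct_cnj (oct_unit b)) (oct_mult (oct_unit a) x)"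
  using oct_mult_left_polarized[of "oct_unit a" "oct_unit b" x]
    oct_mult_left_polarized[of "oct_cnj (oct_unit a)" "oct_cnj (oct_unit b)" x] assms
  by (simp_all add: oct_inner_cnj oct_unit_orthonormal eq_neg_iff_add_eq_0)

definition clifford_pair :: "nat \<Rightarrow> nat \<Rightarrow> oct \<Rightarrow> oct" where
  "clifford_pair a b x = oct_mult (oct_unit a) (oct_mult (oct_cnj (oct_unit b)) x)"

lemma clifford_pair_adjoint: "clifford_pair a b x \<bullet> y = x \<bullet> clifford_pair b a y"
  using oct_inner_left_mult[of "oct_cnj (oct_unit a)"]
  by (simp add: clifford_pair_def oct_inner_left_mult)

definition clifford_word :: "(nat \<Rightarrow> nat) \<Rightarrow> oct \<Rightarrow> oct" where
  "clifford_word t x = clifford_pair (t 0) (t 1) (clifford_pair (t 2) (t 3)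
     (clifford_pair (t 4) (t 5) (clifford_pair (t 6) (t 7) x)))"

lemma clifford_word_adjacent:
  assumes t: "t permutes {..<8}" and i: "Suc i < 8"
  shows "clifford_word (t \<circ> Transposition.transpose i (Suc i)) x = - clifford_word t x"
proof -
  have lt: "t k < 8" if "k < 8" for k
    using permutes_in_image[OF t] that by simp
  have ne: "t k \<noteq> t l" if "k \<noteq> l" for k l
    using permutes_inj[OF t] that by (simp add: inj_eq)
  note swap = oct_unit_swap[OF lt lt ne, of "Suc i" i]
  consider "i = 0" | "i = 1" | "i = 2" | "i = 3" | "i = 4" | "i = 5" | "i = 6"
    using i by linarith
  then show ?thesis
    using swap
    by cases (simp_all add: clifford_word_def clifford_pair_def Transposition.transpose_def oct_mult_uminus
        numeral_2_eq_2 numeral_3_eq_3 eval_nat_numeral)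
qed

text \<open>Any transposition is a product of an odd number of adjacent ones.\<close>

lemma clifford_word_transpose:
  assumes "i < j" "j < 8" and "t permutes {..<8}"
  shows "clifford_word (t \<circ> Transposition.transpose i j) x = - clifford_word t x"
  using assms
proof (induction j arbitrary: t)
  case (Suc j)
  show ?case
  proof (cases "i = j")
    case True
    with Suc.prems show ?thesis
      by (simp only: clifford_word_adjacent)
  next
    case False
    let ?u = "Transposition.transpose j (Suc j)"
    have u: "?u permutes {..<8}" and v: "Transposition.transpose i j permutes {..<8}"
      using Suc.prems False by (auto intro: permutes_swap_id)
    have "Transposition.transpose i (Suc j) = ?u \<circ> Transposition.transpose i j \<circ> ?u"
      using Suc.prems False by (auto simp: fun_eq_iff Transposition.transpose_def)
    then have "clifford_word (t \<circ> Transposition.transpose i (Suc j)) x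
        = clifford_word ((t \<circ> ?u \<circ> Transposition.transpose i j) \<circ> ?u) x"
      by (simp add: o_assoc)
    also have "\<dots> = - clifford_word ((t \<circ> ?u) \<circ> Transposition.transpose i j) x"
      using Suc.prems u v by (intro clifford_word_adjacent permutes_compose) auto
    also have "\<dots> = - (- clifford_word (t \<circ> ?u) x)"
      using Suc.prems False u by (subst Suc.IH) (auto intro!: permutes_compose)
    also have "\<dots> = - clifford_word t x"
      using Suc.prems by (simp add: clifford_word_adjacent)
    finally show ?thesis .
  qed
qed simp

lemma clifford_word_sign:
  assumes "\<sigma> permutes {..<8}"
  shows "clifford_word \<sigma> x = of_int (sign \<sigma>) *\<^sub>R clifford_word id x"
  using finite_lessThan assms
proof (induction \<sigma> rule: permutes_rev_induct)
  case id
  show ?case by simp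
next
  case (swap a b \<sigma>)
  have "clifford_word (\<sigma> \<circ> Transposition.transpose a b) x = - clifford_word \<sigma> x"
    using swap clifford_word_transpose[of a b \<sigma>] clifford_word_transpose[of b a \<sigma>]
    by (cases "a < b") (auto simp: transpose_commute)
  moreover have "sign (\<sigma> \<circ> Transposition.transpose a b) = - sign \<sigma>"
    using swap by (subst sign_compose)
      (auto simp: sign_swap_id intro: permutes_imp_permutation[OF finite_lessThan] permutation_swap_id)
  ultimately show ?case
    by (simp only: swap.IH of_int_minus scaleR_minus_left)
qed

lemma clifford_word_id:
  assumes "j < 8"
  shows "clifford_word id (oct_unit j) = - oct_unit j"
proof -
  have "\<forall>j\<in>{..<8}. clifford_word id (oct_unit j) = - oct_unit j"
    by (simp add: lessThan_nat_numeral lessThan_Suc clifford_word_def clifford_pair_def oct_defs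
      oct_unit_def case_prod_beta prod_eq_iff)
  with assms show ?thesis by auto
qed

lemma oct_parseval: "(\<Sum>i<8. (oct_unit i \<bullet> x) * (oct_unit i \<bullet> y)) = x \<bullet> y"
  using arg_cong[OF oct_expand[of y], of "inner x"] by (simp add: inner_sum_right inner_commute mult_ac)

definition octonionic_line_frame :: "nat \<Rightarrow> oct2" where
  "octonionic_line_frame k = (oct_unit k, 0)"

lemma varpi_octonionic_line:
  assumes ab: "a < 8" "b < 8" "a \<noteq> b" and ij: "i \<le> 8" "j \<le> 8" and v: "v 0 = octonionic_line_frame a" "v 1 = octonionic_line_frame b"
  shows "varpi i j v = (if i < 8 \<and> j < 8 then oct_unit i \<bullet> clifford_pair a b (oct_unit j) else 0)"
proof -
  have I8: "I_op 8 (octonionic_line_frame k) = - octonionic_line_frame k" for k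
    by (simp add: I_op_def octonionic_line_frame_def)
  have I: "I_op m (octonionic_line_frame k) = (0, oct_mult (oct_cnj (oct_unit k)) (oct_unit m))" if "m < 8" for m k
    using that by (simp add: I_op_def octonionic_line_frame_def oct_defs case_prod_beta prod_eq_iff)
  have orth: "octonionic_line_frame k \<bullet> (0, y) = 0" "(0, y) \<bullet> octonionic_line_frame k = 0" for k y
    by (simp_all add: octonionic_line_frame_def)
  have sym: "v 0 \<bullet> I_op i (I_op j (v 1)) = I_op i (octonionic_line_frame a) \<bullet> I_op j (octonionic_line_frame b)"
    by (simp only: v I_op_symmetric)
  have diag: "oct_unit j \<bullet> clifford_pair a b (oct_unit j) = 0"
  proof -
    have "clifford_pair b a (oct_unit j) = - clifford_pair a b (oct_unit j)"
      using oct_unit_swap(1)[of b a] ab by (simp add: clifford_pair_def)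
    then show ?thesis
      using clifford_pair_adjoint[of a b "oct_unit j" "oct_unit j"] by (simp add: inner_commute)
  qed
  show ?thesis
  proof (cases "i < 8 \<and> j < 8")
    case True
    then have "v 0 \<bullet> I_op i (I_op j (v 1)) = oct_unit i \<bullet> clifford_pair a b (oct_unit j)"
      unfolding sym by (simp add: I clifford_pair_def oct_inner_left_mult)
    with True diag show ?thesis
      unfolding varpi_def by auto
  next
    case False
    then consider "i = 8" "j = 8" | "i = 8" "j < 8" | "i < 8" "j = 8"
      using ij by linarith
    then show ?thesis
      unfolding varpi_def sym using False by cases (auto simp: I I8 orth)
  qed
qed

text \<open>On a line the matrix of the values \<open>\<varpi>\<^sub>i\<^sub>j (e\<^sub>a, e\<^sub>b)\<close> is the one of a product of two left multiplications, so
  that the contraction becomes the trace of a product of eight of them. The list is the order in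
  which the contraction visits the arguments.\<close>

lemma four_fold_octonionic_line:
  assumes \<sigma>: "\<sigma> permutes {..<8}"
  defines "\<pi> \<equiv> \<lambda>i. if i < 8 then [3, 2, 0, 1, 5, 4, 6, 7] ! i else i"
  shows "four_fold varpi (\<lambda>k. octonionic_line_frame (\<sigma> k)) = (\<Sum>j<8. oct_unit j \<bullet> clifford_word (\<sigma> \<circ> \<pi>) (oct_unit j))"
proof -
  have lt: "\<sigma> k < 8" if "k < 8" for k
    using permutes_in_image[OF \<sigma>] that by simp
  have ne: "\<sigma> k \<noteq> \<sigma> l" if "k \<noteq> l" for k l
    using permutes_inj[OF \<sigma>] that by (simp add: inj_eq)
  define A where "A a b i j = (if i < 8 \<and> j < 8 then oct_unit i \<bullet> clifford_pair (\<sigma> a) (\<sigma> b) (oct_unit j) else 0)"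
    for a b i j :: nat
  have split: "(\<Sum>i\<le>8. f i) = (\<Sum>i<8. f i) + f 8" for f :: "nat \<Rightarrow> real"
    by (metis lessThan_Suc_atMost sum.lessThan_Suc)
  have pair: "(\<Sum>i<8. A a b i j * A c d i j') =
      clifford_pair (\<sigma> a) (\<sigma> b) (oct_unit j) \<bullet> clifford_pair (\<sigma> c) (\<sigma> d) (oct_unit j')"
    if "j < 8" "j' < 8" for a b c d j j'
    using that by (simp add: A_def oct_parseval)
  have A8: "A a b 8 j = 0" "A a b j 8 = 0" for a b j
    by (simp_all add: A_def)
  have "four_fold varpi (\<lambda>k. octonionic_line_frame (\<sigma> k)) = contraction (A 0 1) (A 2 3) (A 4 5) (A 6 7)"
    unfolding four_fold_def A_def
    by (intro contraction_cong; intro varpi_octonionic_line lt ne) simp_all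
  also have "\<dots> = (\<Sum>j<8. \<Sum>j'<8. (\<Sum>i<8. A 0 1 i j * A 2 3 i j') * (\<Sum>i<8. A 4 5 i j * A 6 7 i j'))"
    unfolding contraction_by_columns by (simp add: split A8)
  also have "\<dots> = (\<Sum>j'<8. \<Sum>j<8.
      (oct_unit j \<bullet> clifford_pair (\<sigma> 1) (\<sigma> 0) (clifford_pair (\<sigma> 2) (\<sigma> 3) (oct_unit j'))) *
      (oct_unit j \<bullet> clifford_pair (\<sigma> 5) (\<sigma> 4) (clifford_pair (\<sigma> 6) (\<sigma> 7) (oct_unit j'))))"
    by (subst sum.swap, intro sum.cong refl) (simp add: pair clifford_pair_adjoint)
  also have "\<dots> = (\<Sum>j<8. oct_unit j \<bullet> clifford_word (\<sigma> \<circ> \<pi>) (oct_unit j))"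
    by (simp add: oct_parseval clifford_pair_adjoint clifford_word_def \<pi>_def)
  finally show ?thesis .
qed

text \<open>The product of eight distinct left multiplications is alternating, hence cancels the sign of the
  permutation: all \<open>8!\<close> terms of the alternating sum are equal and not zero.\<close>

lemma Omega8_octonionic_line: "Omega8 octonionic_line_frame \<noteq> 0"
proof -
  define \<pi> :: "nat \<Rightarrow> nat" where "\<pi> = (\<lambda>i. if i < 8 then [3, 2, 0, 1, 5, 4, 6, 7] ! i else i)"
  have \<pi>: "\<pi> permutes {..<8}"
  proof (rule bij_imp_permutes)
    have "\<pi> ` {..<8} = {..<8}"
      by (simp add: \<pi>_def lessThan_nat_numeral lessThan_Suc) auto
    then show "bij_betw \<pi> {..<8} {..<8}"
      by (simp add: bij_betw_def eq_card_imp_inj_on)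
  qed (simp add: \<pi>_def)
  have "of_int (sign \<sigma>) * four_fold varpi (\<lambda>k. octonionic_line_frame (\<sigma> k)) = - 8 * of_int (sign \<pi>)"
    if \<sigma>: "\<sigma> permutes {..<8}" for \<sigma>
  proof -
    have "oct_unit j \<bullet> clifford_word (\<sigma> \<circ> \<pi>) (oct_unit j) = - of_int (sign \<sigma> * sign \<pi>)" if "j < 8" for j
      using that \<pi> \<sigma> sign_compose[OF permutes_imp_permutation permutes_imp_permutation, OF finite_lessThan \<sigma> finite_lessThan \<pi>]
      by (simp add: clifford_word_sign[OF permutes_compose[OF \<pi> \<sigma>]] clifford_word_id oct_unit_orthonormal)
    then have "four_fold varpi (\<lambda>k. octonionic_line_frame (\<sigma> k)) = - 8 * of_int (sign \<sigma> * sign \<pi>)"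
      unfolding four_fold_octonionic_line[OF \<sigma>] \<pi>_def[symmetric] by simp
    then show ?thesis
      by (simp flip: of_int_mult)
  qed
  then have "Alt 8 (four_fold varpi) octonionic_line_frame = (\<Sum>\<sigma> | \<sigma> permutes {..<8 :: nat}. - 8 * of_int (sign \<pi>))"
    unfolding Alt_def by (intro sum.cong) auto
  then show ?thesis
    by (simp add: Omega8_eq_Alt card_permutations[of "{..<8}" 8])
qed

section \<open>The infinitesimal stabilizer is spanned by the products of two generators\<close>

lemma I_word_intertwine:
  assumes k: "\<And>i x. i < length xs \<Longrightarrow> k (I_op (xs ! i) x) = s *\<^sub>R I_op i (k x)" and lin: "linear k"
    and ys: "\<forall>i\<in>set ys. i < length xs"
  shows "k (I_word (map ((!) xs) ys) x) = s ^ length ys *\<^sub>R I_word ys (k x)"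
  using ys by (induction ys) (auto simp: k I_op_linear_simps)

text \<open>Some element of the spin group conjugates one word into the other up to a sign, which is trivial
  for even length.\<close>

lemma I_word_in_stab_algebra_iff:
  assumes xs: "distinct xs" "set xs \<subseteq> {..8}" and n: "length xs = n" "even n"
  shows "I_word xs \<in> stab_algebra \<longleftrightarrow> I_word [0..<n] \<in> stab_algebra"
proof -
  have len: "n \<le> 9"
    using card_mono[OF _ xs(2)] distinct_card[OF xs(1)] n by simp
  have xi: "xs ! i \<le> 8" if "i < n" for i
    using xs(2) that nth_mem n(1) by fastforce
  have "coeff_inner (coeff_unit (xs ! i)) (coeff_unit (xs ! j)) = (if i = j then 1 else 0)"
    if "i < n" "j < n" for i j
    using that xi xs(1) n(1) by simp (simp add: coeff_unit_def nth_eq_iff_index_eq)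
  then obtain k s where k: "k \<in> rho_Spin9" and s: "s \<in> {1, - 1}"
    and kI: "\<And>i x. i < n \<Longrightarrow> k (I_comb (coeff_unit (xs ! i)) x) = s *\<^sub>R I_op i (k x)"
    using rho_Spin9_frame_to_basis[of n "\<lambda>i. coeff_unit (xs ! i)"] len by blast
  obtain k' where k': "k' \<in> rho_Spin9" "k' \<circ> k = id" "k \<circ> k' = id"
    using rho_Spin9_inverse[OF k] .
  have inv: "k' (k x) = x" "k (k' x) = x" for x
    using k'(2,3) by (metis comp_apply id_apply)+
  have lin: "linear k" "linear k'"
    using stabilizes_Omega8_rho_Spin9 k k'(1) by (auto simp: stabilizes_Omega8_def)
  have "s ^ n = 1"
    using s n(2) by auto
  then have word: "k (I_word xs x) = I_word [0..<n] (k x)" for x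
    using I_word_intertwine[of xs k s "[0..<n]" x] kI xi lin n(1) by (simp add: I_comb_coeff_unit map_nth[of xs, unfolded n(1)])
  show ?thesis
  proof
    assume "I_word xs \<in> stab_algebra"
    from stab_algebra_conj[OF this stabilizes_Omega8_rho_Spin9[OF k] lin(2) inv(2)]
    show "I_word [0..<n] \<in> stab_algebra"
      by (simp add: word inv)
  next
    assume "I_word [0..<n] \<in> stab_algebra"
    from stab_algebra_conj[OF this stabilizes_Omega8_rho_Spin9[OF k'(1)] lin(1) inv(1)]
    show "I_word xs \<in> stab_algebra"
      by (simp add: inv flip: word)
  qed
qed

text \<open>A derivation that acts as a scalar on the line multiplies the value of the form there by eight times
  that scalar.\<close>

lemma scaling_notin_stab_algebra:
  assumes "\<And>k. k < 8 \<Longrightarrow> X (octonionic_line_frame k) = c *\<^sub>R octonionic_line_frame k" "c \<noteq> 0"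
  shows "X \<notin> stab_algebra"
proof
  assume "X \<in> stab_algebra"
  from stab_algebraD[OF this, of octonionic_line_frame]
  have "8 * c * Omega8 octonionic_line_frame = 0"
    using assms(1) by (simp add: Omega8_slot_linear)
  with assms(2) Omega8_octonionic_line show False
    by simp
qed

lemma stab_algebra_zero: "(\<lambda>x. 0) \<in> stab_algebra"
  by (simp add: stab_algebra_def Omega8_slot_linear linear_iff)

text \<open>The witness is the infinitesimal rotation in the plane of the last vector of the line frame and a
  vector orthogonal to the line. Its derivation, evaluated at the frame with the former vector
  replaced by the latter, gives the negative of the value of the form on the line.\<close>

lemma not_all_skew_in_stab_algebra:
  "\<exists>X. linear X \<and> (\<forall>x y. X x \<bullet> y = - (x \<bullet> X y)) \<and> X \<notin> stab_algebra"
proof -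
  define e f :: oct2 where "e = octonionic_line_frame 7" and "f = (0, oct_unit 0)"
  define X where "X x = (x \<bullet> e) *\<^sub>R f - (x \<bullet> f) *\<^sub>R e" for x
  have "linear X"
    unfolding X_def by (rule linearI) (simp_all add: algebra_simps inner_add_left)
  moreover have "X x \<bullet> y = - (x \<bullet> X y)" for x y
    by (simp add: X_def algebra_simps inner_diff_left inner_diff_right inner_commute)
  moreover have "X \<notin> stab_algebra"
  proof
    assume X: "X \<in> stab_algebra"
    have "X (octonionic_line_frame k) = 0" if "k < 7" for k
      using that by (simp add: X_def e_def f_def octonionic_line_frame_def oct_unit_orthonormal)
    have "X f = - e"
      by (simp add: X_def e_def f_def octonionic_line_frame_def oct_unit_orthonormal)
    have "Omega8 ((octonionic_line_frame(7 := f))(k := X ((octonionic_line_frame(7 := f)) k)))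
        = (if k = 7 then - Omega8 octonionic_line_frame else 0)" if "k < 8" for k
    proof (cases "k = 7")
      case True
      with \<open>X f = - e\<close> Omega8_slot_linear(4)[of 7 octonionic_line_frame e] show ?thesis
        by (simp add: e_def del: fun_upd_apply) simp
    next
      case False
      with that have "X ((octonionic_line_frame(7 := f)) k) = 0"
        using \<open>\<And>k. k < 7 \<Longrightarrow> X (octonionic_line_frame k) = 0\<close>[of k] by simp
      with False Omega8_slot_linear(5)[OF that] show ?thesis
        by (simp del: fun_upd_apply)
    qed
    then have "(\<Sum>k<8. Omega8 ((octonionic_line_frame(7 := f))(k := X ((octonionic_line_frame(7 := f)) k)))) = - Omega8 octonionic_line_frame"
      by simp
    with stab_algebraD[OF X, of "octonionic_line_frame(7 := f)"] Omega8_octonionic_line show False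
      by (simp del: fun_upd_apply)
  qed
  ultimately show ?thesis by blast
qed

lemma half_sum_in_stab_algebra:
  assumes "X \<in> stab_algebra" "i \<le> 8"
  shows "(\<lambda>x. (1 / 2) *\<^sub>R (X x + s *\<^sub>R I_op i (X (I_op i x)))) \<in> stab_algebra"
  using assms stab_algebra_conj[OF assms(1) stabilizes_Omega8_I_op[OF assms(2)] linear_I_op[of i]]
  by (intro stab_algebra_scale stab_algebra_add) simp_all

lemma even_length_cases:
  assumes "distinct xs" "set xs \<subseteq> {..8 :: nat}" "even (length xs)"
  shows "length xs \<in> {0, 2, 4, 6, 8}"
proof -
  have "length xs \<le> 9"
    using card_mono[of "{..8 :: nat}" "set xs"] distinct_card[of xs] assms by simp
  with assms(3) show ?thesis
    by (simp del: length_0_conv) presburger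
qed

text \<open>The skew operators are spanned by the words of lengths 2 and 6. With the latter, the infinitesimal
  stabilizer would contain all of them.\<close>

lemma I_word_6_notin_stab_algebra: "I_word [0..<6] \<notin> stab_algebra"
proof
  assume six: "I_word [0..<6] \<in> stab_algebra"
  define W where "W = {X :: oct2 \<Rightarrow> oct2. linear X \<and> (\<forall>x y. X x \<bullet> y = - (x \<bullet> X y))}"
  have "X \<in> stab_algebra" if "X \<in> W" for X
    using that
  proof (rule sign_pattern_induct)
    show "linear X" if "X \<in> W" for X
      using that by (simp add: W_def)
    show "(\<lambda>x. (1 / 2) *\<^sub>R (X x + s *\<^sub>R I_op i (X (I_op i x)))) \<in> W" if "X \<in> W" for X i s
    proof -
      have "linear (\<lambda>x. (1 / 2) *\<^sub>R (X x + s *\<^sub>R I_op i (X (I_op i x))))"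
        using that linear_compose[OF linear_compose[OF linear_I_op[of i]] linear_I_op[of i], of X]
        by (intro linear_compose_scale_right linear_compose_add) (auto simp: W_def o_def)
      with that show ?thesis
        by (simp add: W_def inner_add_left inner_add_right I_op_symmetric algebra_simps)
    qed
    fix X \<epsilon> assume X: "X \<in> W" "sign_pattern \<epsilon> X"
    show "X \<in> stab_algebra"
    proof (cases "\<exists>x. X x \<noteq> 0")
      case False
      then have "X = (\<lambda>x. 0)" by auto
      then show ?thesis by (simp add: stab_algebra_zero)
    next
      case True
      then obtain x where x: "X x \<noteq> 0" by blast
      have lin: "linear X" using X(1) by (simp add: W_def)
      define xs where "xs = filter (\<lambda>i. \<epsilon> i = - 1) [0..<9]"
      obtain c where xs_even: "even (length xs)" and Xc: "X = (\<lambda>x. c *\<^sub>R I_word xs x)"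
        using sign_pattern_imp_I_word[OF lin X(2) x] unfolding xs_def .
      have xs: "distinct xs" "set xs \<subseteq> {..8}"
        by (auto simp: xs_def)
      have "odd (length xs choose 2)"
      proof
        assume ev: "even (length xs choose 2)"
        have "X x \<bullet> X x = X x \<bullet> c *\<^sub>R I_word xs x"
          by (simp add: Xc)
        also have "\<dots> = c * (I_word xs (X x) \<bullet> x)"
          using ev by (simp add: I_word_adjoint I_word_rev[OF xs])
        also have "\<dots> = X (X x) \<bullet> x"
          by (simp add: Xc)
        also have "\<dots> = - (X x \<bullet> X x)"
          using X(1) by (simp add: W_def)
        finally show False
          using x by simp
      qed
      moreover have "length xs \<in> {0, 2, 4, 6, 8}"
        by (rule even_length_cases[OF xs xs_even])
      ultimately have "length xs = 2 \<or> length xs = 6"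
        by (auto simp: choose_two)
      moreover have "I_word [0..<2] \<in> stab_algebra"
        using I_op_I_op_in_stab_algebra[of 0 1] by (simp add: upt_rec I_word_def o_def)
      ultimately have "I_word xs \<in> stab_algebra"
        using six I_word_in_stab_algebra_iff[OF xs refl xs_even] by auto
      then show ?thesis
        unfolding Xc by (rule stab_algebra_scale)
    qed
  qed (rule stab_algebra_add)
  with not_all_skew_in_stab_algebra show False
    by (auto simp: W_def)
qed

text \<open>Two words of length 4 with one index in common anticommute, and their product is a word of
  length 6.\<close>

lemma I_word_4_notin_stab_algebra: "I_word [0..<4] \<notin> stab_algebra"
proof
  assume four: "I_word [0..<4] \<in> stab_algebra"
  have A: "I_word [0, 1, 2, 3] \<in> stab_algebra"
  proof -
    have "[0..<4] = [0, 1, 2, 3 :: nat]"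
      by (simp add: upt_rec)
    with four show ?thesis by simp
  qed
  have B: "I_word [3, 4, 5, 6] \<in> stab_algebra"
    using four I_word_in_stab_algebra_iff[of "[3, 4, 5, 6]" 4] by simp
  have anti: "I_op j (I_op i x) = - I_op i (I_op j x)" if "i < j" "j \<le> 8" for i j x
    using that I_op_commute[of j i x] by (simp add: commutation_sign_def)
  have "I_word [0, 1, 2, 3] (I_word [3, 4, 5, 6] x) - I_word [3, 4, 5, 6] (I_word [0, 1, 2, 3] x)
      = 2 *\<^sub>R I_word [0, 1, 2, 4, 5, 6] x" for x
    by (simp add: anti I_op_linear_simps scaleR_2)
  with stab_algebra_scale[OF stab_algebra_bracket[OF A B], of "1 / 2"]
  have "(\<lambda>x. (1 / 2) *\<^sub>R 2 *\<^sub>R I_word [0, 1, 2, 4, 5, 6] x) \<in> stab_algebra"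
    by (simp only:)
  then have "I_word [0, 1, 2, 4, 5, 6] \<in> stab_algebra"
    by (simp del: I_word_simps)
  then show False
    using I_word_6_notin_stab_algebra I_word_in_stab_algebra_iff[of "[0, 1, 2, 4, 5, 6]" 6] by simp
qed

lemma I_word_in_stab_algebra_length:
  assumes xs: "distinct xs" "set xs \<subseteq> {..8}" "even (length xs)" and "I_word xs \<in> stab_algebra"
  shows "length xs = 2"
proof -
  have *: "I_word [0..<length xs] \<in> stab_algebra"
    using assms I_word_in_stab_algebra_iff by blast
  have "length xs \<in> {0, 2, 4, 6, 8}"
    by (rule even_length_cases[OF xs])
  moreover have "length xs \<noteq> 0"
    using * scaling_notin_stab_algebra[of "I_word []" 1] by auto
  moreover have "I_word [0..<8] x = I_op 8 x" for x
  proof -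
    have "[0..<9] = [0..<8] @ [8]"
      using upt_add_eq_append[of 0 8 1] by simp
    with I_word_volume[of "I_op 8 x"] show ?thesis
      by (simp add: I_word_append)
  qed
  then have "I_word [0..<8] \<notin> stab_algebra"
    by (intro scaling_notin_stab_algebra[where c = "- 1"]) (simp_all add: octonionic_line_frame_def I_op_def)
  then have "length xs \<noteq> 8"
    using * by auto
  ultimately show ?thesis
    using * I_word_4_notin_stab_algebra I_word_6_notin_stab_algebra by auto
qed

text \<open>An index is a pair \<open>(j, i)\<close> with \<open>i < j\<close>, the larger one first so that the set is a dependent product.\<close>

definition plane_index :: "(nat \<times> nat) set" where
  "plane_index = (SIGMA j:{..8}. {..<j})"

definition plane_op :: "nat \<times> nat \<Rightarrow> oct2 \<Rightarrow> oct2" where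
  "plane_op p x = I_op (fst p) (I_op (snd p) x)"

lemma finite_plane_index [simp]: "finite plane_index"
  by (simp add: plane_index_def)

lemma stab_algebra_imp_span:
  assumes "X \<in> stab_algebra"
  obtains A where "\<And>x. X x = (\<Sum>p\<in>plane_index. A p *\<^sub>R plane_op p x)"
proof -
  define S where "S = {X. \<exists>A. X = (\<lambda>x. \<Sum>p\<in>plane_index. A p *\<^sub>R plane_op p x)}"
  from assms have "X \<in> S"
  proof (rule sign_pattern_induct)
    show "(\<lambda>x. X x + Y x) \<in> S" if "X \<in> S" "Y \<in> S" for X Y
    proof -
      obtain A B where "X = (\<lambda>x. \<Sum>p\<in>plane_index. A p *\<^sub>R plane_op p x)"
        "Y = (\<lambda>x. \<Sum>p\<in>plane_index. B p *\<^sub>R plane_op p x)"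
        using \<open>X \<in> S\<close> \<open>Y \<in> S\<close> by (auto simp: S_def)
      then show ?thesis
        unfolding S_def by (auto intro!: exI[of _ "\<lambda>p. A p + B p"] simp: sum.distrib scaleR_add_left)
    qed
    fix X \<epsilon> assume X: "X \<in> stab_algebra" "sign_pattern \<epsilon> X"
    show "X \<in> S"
    proof (cases "\<exists>x. X x \<noteq> 0")
      case False
      then have "X = (\<lambda>x. \<Sum>p\<in>plane_index. 0 *\<^sub>R plane_op p x)" by auto
      then show ?thesis by (auto simp only: S_def)
    next
      case True
      then obtain x where x: "X x \<noteq> 0" by blast
      define xs where "xs = filter (\<lambda>i. \<epsilon> i = - 1) [0..<9]"
      obtain c where xs_even: "even (length xs)" and Xc: "X = (\<lambda>x. c *\<^sub>R I_word xs x)"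
        using sign_pattern_imp_I_word[OF stab_algebra_linear[OF X(1)] X(2) x] unfolding xs_def .
      have xs: "distinct xs" "set xs \<subseteq> {..8}" "sorted xs"
        by (auto simp: xs_def intro: sorted_wrt_filter)
      have "c \<noteq> 0"
        using x Xc by auto
      then have "I_word xs \<in> stab_algebra"
        using stab_algebra_scale[OF X(1), of "1 / c"] by (simp add: Xc)
      then have "length xs = 2"
        by (rule I_word_in_stab_algebra_length[OF xs(1,2) xs_even])
      then obtain i j where ij: "xs = [i, j]"
        by (auto simp: numeral_2_eq_2 length_Suc_conv)
      then have mem: "i < j" "j \<le> 8"
        using xs by auto
      have "X x = (\<Sum>p\<in>plane_index. (if p = (j, i) then - c else 0) *\<^sub>R plane_op p x)" for x
      proof -
        have "(\<Sum>p\<in>plane_index. (if p = (j, i) then - c else 0) *\<^sub>R plane_op p x)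
            = (\<Sum>p\<in>plane_index. if p = (j, i) then - c *\<^sub>R plane_op (j, i) x else 0)"
          by (intro sum.cong) auto
        also have "\<dots> = X x"
          using mem I_op_commute[of i j x]
          by (simp add: plane_index_def Xc ij plane_op_def commutation_sign_def)
        finally show ?thesis by simp
      qed
      then have "X = (\<lambda>x. \<Sum>p\<in>plane_index. (if p = (j, i) then - c else 0) *\<^sub>R plane_op p x)"
        by (rule ext)
      then show ?thesis
        unfolding S_def mem_Collect_eq by (rule exI[of _ "\<lambda>p. if p = (j, i) then - c else 0"])
    qed
  qed (use stab_algebra_linear half_sum_in_stab_algebra in auto)
  with that show thesis
    by (auto simp: S_def)
qed

section \<open>The Casimir operator\<close>

definition op_trace :: "('a::euclidean_space \<Rightarrow> 'a) \<Rightarrow> real" where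
  "op_trace X = (\<Sum>b\<in>Basis. X b \<bullet> b)"

lemma op_trace_commute:
  fixes X Y :: "'a::euclidean_space \<Rightarrow> 'a"
  assumes "linear X" "linear Y"
  shows "op_trace (\<lambda>x. X (Y x)) = op_trace (\<lambda>x. Y (X x))"
proof -
  have *: "op_trace (\<lambda>x. X (Y x)) = (\<Sum>b\<in>Basis. \<Sum>c\<in>Basis. (Y b \<bullet> c) * (X c \<bullet> b))"
    if "linear X" for X Y :: "'a \<Rightarrow> 'a"
  proof -
    have "X (Y b) = (\<Sum>c\<in>Basis. (Y b \<bullet> c) *\<^sub>R X c)" for b
      using arg_cong[OF euclidean_representation[of "Y b"], of X]
      by (simp add: linear_sum[OF that] linear_scale[OF that])
    then show ?thesis
      by (simp add: op_trace_def inner_sum_left)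
  qed
  show ?thesis
    unfolding *[OF assms(1)] *[OF assms(2)] by (subst sum.swap) (simp add: mult.commute)
qed

lemma linear_plane_op: "linear (plane_op p)"
  using linear_compose[OF linear_I_op linear_I_op] by (simp add: plane_op_def[abs_def] o_def)

lemma plane_op_I_op:
  assumes "p \<in> plane_index" "i \<le> 8"
  shows "I_op i (plane_op p x) = (commutation_sign i (fst p) * commutation_sign i (snd p)) *\<^sub>R plane_op p (I_op i x)"
  using assms by (auto simp: plane_index_def plane_op_def I_op_commute[of i] I_op_linear_simps)

lemma op_trace_plane_op:
  assumes p: "p \<in> plane_index" and q: "q \<in> plane_index"
  shows "op_trace (\<lambda>x. plane_op p (plane_op q x)) = (if p = q then - real DIM(oct2) else 0)"
proof (cases "p = q")
  case True
  have "plane_op q (plane_op q x) = - x" for x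
  proof -
    obtain j i where ji: "q = (j, i)" "i < j" "j \<le> 8"
      using q by (auto simp: plane_index_def)
    then show ?thesis
      using I_op_commute[of i j "I_op i x"] by (simp add: plane_op_def commutation_sign_def I_op_linear_simps)
  qed
  with True show ?thesis
    by (simp add: op_trace_def inner_same_Basis sum_negf)
next
  case False
  obtain j i l k where pq: "p = (j, i)" "q = (l, k)" and ord: "i < j" "j \<le> 8" "k < l" "l \<le> 8"
    using p q by (auto simp: plane_index_def)
  \<comment> \<open>A generator that occurs in exactly one of the two products anticommutes with their composition,
    whose trace must then vanish.\<close>
  have "\<exists>m\<le>8. commutation_sign m j * commutation_sign m i * (commutation_sign m l * commutation_sign m k) = - 1"
  proof -
    consider "i \<noteq> k" "i \<noteq> l" | "j \<noteq> k" "j \<noteq> l" | "i = k" "j = l"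
      using ord by linarith
    then show ?thesis
    proof cases
      case 1
      with ord show ?thesis by (intro exI[of _ i]) (auto simp: commutation_sign_def)
    next
      case 2
      with ord show ?thesis by (intro exI[of _ j]) (auto simp: commutation_sign_def)
    next
      case 3
      with False pq show ?thesis by simp
    qed
  qed
  then obtain m where m: "m \<le> 8"
    and sgn: "commutation_sign m j * commutation_sign m i * (commutation_sign m l * commutation_sign m k) = - 1" by blast
  let ?Z = "\<lambda>x. plane_op p (plane_op q x)"
  have anti: "I_op m (?Z x) = - ?Z (I_op m x)" for x
  proof -
    have "I_op m (?Z x) = (commutation_sign m (fst p) * commutation_sign m (snd p) * (commutation_sign m (fst q) * commutation_sign m (snd q))) *\<^sub>R ?Z (I_op m x)"
      by (simp add: plane_op_I_op[OF p m] plane_op_I_op[OF q m] linear_scale[OF linear_plane_op])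
    then show ?thesis
      by (simp only: sgn scaleR_minus1_left pq fst_conv snd_conv)
  qed
  have Z: "linear ?Z"
    using linear_compose[OF linear_plane_op linear_plane_op] by (simp add: o_def)
  have "op_trace ?Z = op_trace (\<lambda>x. I_op m (I_op m (?Z x)))"
    using m by simp
  also have "\<dots> = op_trace (\<lambda>x. I_op m (?Z (I_op m x)))"
    using op_trace_commute[OF linear_I_op linear_compose[OF Z linear_I_op], of m m] by (simp add: o_def)
  also have "\<dots> = - op_trace ?Z"
    using m by (simp add: anti op_trace_def sum_negf)
  finally show ?thesis
    using False by simp
qed

text \<open>Among nine signs, this symmetric function only depends on the number of minus signs, which is the
  length of a word.\<close>

lemma sum_plane_index_signs:
  fixes \<epsilon> :: "nat \<Rightarrow> real"
  assumes "\<And>i. i \<le> 8 \<Longrightarrow> \<epsilon> i \<in> {1, - 1}"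
  shows "2 * (\<Sum>p\<in>plane_index. \<epsilon> (fst p) * \<epsilon> (snd p)) = (\<Sum>i\<le>8. \<epsilon> i)\<^sup>2 - 9"
proof -
  have *: "2 * (\<Sum>j\<le>n. \<Sum>i<j. \<epsilon> j * \<epsilon> i) = (\<Sum>i\<le>n. \<epsilon> i)\<^sup>2 - (\<Sum>i\<le>n. (\<epsilon> i)\<^sup>2)" for n :: nat
    by (induction n) (simp_all add: power2_eq_square algebra_simps lessThan_Suc_atMost flip: sum_distrib_left)
  have "(\<epsilon> i)\<^sup>2 = 1" if "i \<le> 8" for i
    using assms[OF that] by auto
  then have "(\<Sum>i\<le>8. (\<epsilon> i)\<^sup>2) = (\<Sum>i\<le>(8::nat). 1)"
    by (intro sum.cong) auto
  with * [of 8] show ?thesis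
    by (simp add: plane_index_def sum.Sigma case_prod_beta)
qed

text \<open>The basis operators \<open>I\<^sub>j I\<^sub>i\<close> square to \<open>- 1\<close>, so this is, up to sign, the sum of the conjugations by
  an orthonormal basis of \<open>spin(9)\<close>.\<close>

definition casimir :: "(oct2 \<Rightarrow> oct2) \<Rightarrow> oct2 \<Rightarrow> oct2" where
  "casimir Y x = (\<Sum>p\<in>plane_index. plane_op p (Y (plane_op p x)))"

lemma casimir_sign_pattern:
  assumes Y: "linear Y" "sign_pattern \<epsilon> Y"
  shows "casimir Y x = - (\<Sum>p\<in>plane_index. \<epsilon> (fst p) * \<epsilon> (snd p)) *\<^sub>R Y x"
proof -
  have "plane_op p (Y (plane_op p x)) = - (\<epsilon> (fst p) * \<epsilon> (snd p)) *\<^sub>R Y x" if p: "p \<in> plane_index" for p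
  proof -
    obtain j i where ji: "p = (j, i)" "i < j" "j \<le> 8"
      using p by (auto simp: plane_index_def)
    have pull: "I_op m (Y y) = \<epsilon> m *\<^sub>R Y (I_op m y)" if "m \<le> 8" for m y
      using Y(2) that by (simp add: sign_pattern_def)
    have "I_op j (I_op i (I_op j (I_op i x))) = - x"
      using ji I_op_commute[of i j "I_op i x"] by (simp add: commutation_sign_def I_op_linear_simps)
    then show ?thesis
      using ji by (simp add: plane_op_def pull I_op_linear_simps linear_neg[OF Y(1)] mult.commute)
  qed
  then show ?thesis
    by (simp add: casimir_def sum_negf scaleR_sum_left)
qed

lemma casimir_I_op:
  assumes "j \<le> 8"
  shows "casimir (I_op j) x = - 20 *\<^sub>R I_op j x"
proof -
  have "sign_pattern (\<lambda>i. commutation_sign i j) (I_op j)"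
    unfolding sign_pattern_def
  proof (intro allI impI conjI)
    show "commutation_sign i j \<in> {1, - 1}" for i
      by (simp add: commutation_sign_def)
    show "I_op i (I_op j x) = commutation_sign i j *\<^sub>R I_op j (I_op i x)" if "i \<le> 8" for i x
      by (rule I_op_commute[OF that assms])
  qed
  moreover have "(\<Sum>i\<le>8. commutation_sign i j) = - 7"
  proof -
    have "(\<Sum>i\<le>8. commutation_sign i j) = (\<Sum>i\<le>8. (if i = j then 2 else 0) - 1)"
      by (intro sum.cong) (auto simp: commutation_sign_def)
    with assms show ?thesis
      by (simp add: sum_subtractf)
  qed
  then have "(\<Sum>p\<in>plane_index. commutation_sign (fst p) j * commutation_sign (snd p) j) = 20"
    using sum_plane_index_signs[of "\<lambda>i. commutation_sign i j"] by (simp add: commutation_sign_def[abs_def])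
  ultimately show ?thesis
    using casimir_sign_pattern[OF linear_I_op] by simp
qed

lemma casimir_conj_I_op:
  assumes X: "linear X" and i: "i \<le> 8"
  shows "casimir (\<lambda>x. I_op i (X (I_op i x))) x = I_op i (casimir X (I_op i x))"
proof -
  have "plane_op p (I_op i (X (I_op i (plane_op p x)))) = I_op i (plane_op p (X (plane_op p (I_op i x))))"
    if p: "p \<in> plane_index" for p
  proof -
    define s where "s = commutation_sign i (fst p) * commutation_sign i (snd p)"
    have s: "s * s = 1"
      by (simp add: s_def commutation_sign_def)
    have c: "I_op i (plane_op p y) = s *\<^sub>R plane_op p (I_op i y)" for y
      using plane_op_I_op[OF p i] by (simp add: s_def)
    then have c': "plane_op p (I_op i y) = s *\<^sub>R I_op i (plane_op p y)" for y
      by (simp add: s)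
    show ?thesis
      unfolding c'[of "X (I_op i (plane_op p x))"] c[of x]
      by (simp add: linear_scale[OF X] linear_scale[OF linear_plane_op] I_op_linear_simps s c)
  qed
  then show ?thesis
    by (simp add: casimir_def I_op_linear_simps)
qed

text \<open>The eigenvalue \<open>- 20\<close> singles out the sign patterns of the single generators: it requires \<open>\<Sum> \<epsilon>\<^sub>i = \<plusminus> 7\<close>,
  and the sum 7, with one minus sign, is impossible by parity.\<close>

lemma casimir_eigenspace:
  assumes Y: "linear Y" "\<And>x. casimir Y x = - 20 *\<^sub>R Y x"
  obtains a where "Y = I_comb a"
proof -
  define W where "W = {Y. linear Y \<and> (\<forall>x. casimir Y x = - 20 *\<^sub>R Y x)}"
  define S where "S = range I_comb"
  have "Y \<in> W"
    using Y by (simp add: W_def)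
  then have "Y \<in> S"
  proof (rule sign_pattern_induct)
    show "linear X" if "X \<in> W" for X
      using that by (simp add: W_def)
    show "(\<lambda>x. (1 / 2) *\<^sub>R (X x + s *\<^sub>R I_op i (X (I_op i x)))) \<in> W" if X: "X \<in> W" and i: "i \<le> 8" for X i s
    proof -
      have lX: "linear X" using X by (simp add: W_def)
      have "linear (\<lambda>x. (1 / 2) *\<^sub>R (X x + s *\<^sub>R I_op i (X (I_op i x))))"
        using lX linear_compose[OF linear_compose[OF linear_I_op[of i] lX] linear_I_op[of i]]
        by (intro linear_compose_scale_right linear_compose_add) (auto simp: o_def)
      moreover have "casimir (\<lambda>x. (1 / 2) *\<^sub>R (X x + s *\<^sub>R I_op i (X (I_op i x)))) x
          = (1 / 2) *\<^sub>R (casimir X x + s *\<^sub>R casimir (\<lambda>x. I_op i (X (I_op i x))) x)" for x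
        by (simp add: casimir_def linear_scale[OF linear_plane_op] linear_add[OF linear_plane_op]
          sum.distrib scaleR_add_right flip: scaleR_sum_right)
      ultimately show ?thesis
        using X i by (simp add: W_def casimir_conj_I_op[OF lX i] I_op_linear_simps algebra_simps)
    qed
    show "(\<lambda>x. X x + Y x) \<in> S" if "X \<in> S" "Y \<in> S" for X Y
    proof -
      obtain a b where "X = I_comb a" "Y = I_comb b"
        using \<open>X \<in> S\<close> \<open>Y \<in> S\<close> by (auto simp: S_def)
      then have "(\<lambda>x. X x + Y x) = I_comb (\<lambda>i. a i + b i)"
        by (simp add: I_comb_def fun_eq_iff sum.distrib scaleR_add_left)
      then show ?thesis by (simp add: S_def)
    qed
    fix X \<epsilon> assume X: "X \<in> W" "sign_pattern \<epsilon> X"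
    show "X \<in> S"
    proof (cases "\<exists>x. X x \<noteq> 0")
      case False
      then have "X = I_comb (\<lambda>i. 0)"
        by (auto simp: I_comb_def)
      then show ?thesis by (simp add: S_def)
    next
      case True
      then obtain x where x: "X x \<noteq> 0" by blast
      have lX: "linear X" using X by (simp add: W_def)
      have sgn: "\<epsilon> i \<in> {1, - 1}" if "i \<le> 8" for i
        using X(2) that by (simp add: sign_pattern_def)
      define xs where "xs = filter (\<lambda>i. \<epsilon> i = - 1) [0..<9]"
      have even: "even (length xs)"
        using sign_pattern_imp_I_word[OF lX X(2) x] unfolding xs_def by blast
      have xs: "distinct xs" "set xs \<subseteq> {..8}"
        by (auto simp: xs_def)
      have eps: "\<epsilon> i = (if i \<in> set xs then - 1 else 1)" if "i \<le> 8" for i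
        using sgn[OF that] that by (auto simp: xs_def)
      have "- 20 *\<^sub>R X x = - (\<Sum>p\<in>plane_index. \<epsilon> (fst p) * \<epsilon> (snd p)) *\<^sub>R X x"
        using casimir_sign_pattern[OF lX X(2), of x] X(1) by (simp add: W_def)
      then have "(\<Sum>p\<in>plane_index. \<epsilon> (fst p) * \<epsilon> (snd p)) = 20"
        using x by simp
      then have "(\<Sum>i\<le>8. \<epsilon> i)\<^sup>2 = 49"
        using sum_plane_index_signs[of \<epsilon>, OF sgn] by simp
      moreover have "(\<Sum>i\<le>8. \<epsilon> i) = 9 - 2 * real (length xs)"
      proof -
        have "(\<Sum>i\<le>8. \<epsilon> i) = (\<Sum>i\<le>8. 1 - 2 * (if i \<in> set xs then 1 else 0))"
          by (intro sum.cong) (auto simp: eps)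
        also have "\<dots> = 9 - 2 * (\<Sum>i\<in>{..8} \<inter> set xs. 1)"
          by (simp add: sum_subtractf sum.If_cases flip: sum_distrib_left)
        also have "{..8} \<inter> set xs = set xs"
          using xs by blast
        finally show ?thesis
          using distinct_card[OF xs(1)] by simp
      qed
      ultimately have "(9 - 2 * real (length xs))\<^sup>2 = 49"
        by simp
      with even_length_cases[OF xs even] have len: "length xs = 8"
        by (auto simp: power2_eq_square)
      have "card ({..8} - set xs) = 1"
        using xs len distinct_card[OF xs(1)] by (subst card_Diff_subset) auto
      then obtain j where "{..8} - set xs = {j}"
        by (auto simp: card_1_singleton_iff)
      then have j: "j \<le> 8" "\<And>i. i \<le> 8 \<Longrightarrow> i \<notin> set xs \<longleftrightarrow> i = j"
        by blast+
      have "X (I_op j (I_op i y)) = I_op i (X (I_op j y))" if i: "i \<le> 8" for i y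
      proof -
        have "\<epsilon> i = commutation_sign i j"
          using eps[OF i] j(2)[OF i] by (auto simp: commutation_sign_def)
        then have "I_op i (X (I_op j y)) = commutation_sign i j *\<^sub>R X (I_op i (I_op j y))"
          using X(2) i by (simp add: sign_pattern_def)
        also have "I_op i (I_op j y) = commutation_sign i j *\<^sub>R I_op j (I_op i y)"
          by (rule I_op_commute[OF i j(1)])
        finally show ?thesis
          by (simp add: linear_scale[OF lX]) (simp add: commutation_sign_def)
      qed
      then obtain c where c: "\<And>y. X (I_op j y) = c *\<^sub>R y"
        using linear_eq_scaleR_if_commutes[of "\<lambda>y. X (I_op j y)"] linear_compose[OF linear_I_op lX, of j]
        unfolding o_def by blast
      have "X y = I_comb (\<lambda>k. c * coeff_unit j k) y" for y
        using c[of "I_op j y"] j(1) I_comb_lincomb[of c "coeff_unit j" 0 "coeff_unit j" y]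
        by (simp add: I_comb_coeff_unit)
      then have "X = I_comb (\<lambda>k. c * coeff_unit j k)" by (rule ext)
      then show ?thesis by (simp add: S_def)
    qed
  qed
  with that show thesis by (auto simp: S_def)
qed

section \<open>From the Lie algebra to the group\<close>

text \<open>Conjugation by \<open>g\<close> maps the span of the \<open>I\<^sub>j I\<^sub>i\<close> to itself and preserves the trace form, for which the
  \<open>I\<^sub>j I\<^sub>i\<close> are orthogonal of equal length. It is therefore given by an orthogonal matrix \<open>A\<close>, and it
  commutes with the Casimir operator.\<close>

lemma conj_I_op_eq_I_comb:
  assumes g: "stabilizes_Omega8 g" and h: "stabilizes_Omega8 h" and gh: "\<And>x. g (h x) = x" "\<And>x. h (g x) = x"
    and j: "j \<le> 8"
  obtains a where "\<And>x. g (I_op j (h x)) = I_comb a x"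
proof -
  have lg: "linear g" and lh: "linear h"
    using g h by (auto simp: stabilizes_Omega8_def)
  have alg: "plane_op p \<in> stab_algebra" if "p \<in> plane_index" for p
    using I_op_I_op_in_stab_algebra[of "fst p" "snd p"] that
    by (auto simp: plane_index_def plane_op_def[abs_def])
  \<comment> \<open>Stated for \<open>g\<close> and \<open>h\<close> at once, because both conjugations are used below.\<close>
  have matrix: "\<exists>A. \<forall>p\<in>plane_index. \<forall>x. g (plane_op p (h x)) = (\<Sum>q\<in>plane_index. A p q *\<^sub>R plane_op q x)"
    if gh: "stabilizes_Omega8 g" "linear h" "\<And>x. g (h x) = x" for g h
  proof (rule bchoice, rule ballI)
    fix p assume "p \<in> plane_index"
    obtain A where "\<And>x. g (plane_op p (h x)) = (\<Sum>q\<in>plane_index. A q *\<^sub>R plane_op q x)"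
      using stab_algebra_imp_span[OF stab_algebra_conj[OF alg[OF \<open>p \<in> plane_index\<close>] gh]] by blast
    then show "\<exists>A. \<forall>x. g (plane_op p (h x)) = (\<Sum>q\<in>plane_index. A q *\<^sub>R plane_op q x)"
      by blast
  qed
  obtain A where A: "\<And>p x. p \<in> plane_index \<Longrightarrow> g (plane_op p (h x)) = (\<Sum>q\<in>plane_index. A p q *\<^sub>R plane_op q x)"
    using matrix[OF g lh gh(1)] by blast
  obtain B where B: "\<And>p x. p \<in> plane_index \<Longrightarrow> h (plane_op p (g x)) = (\<Sum>q\<in>plane_index. B p q *\<^sub>R plane_op q x)"
    using matrix[OF h lg gh(2)] by blast
  have tr: "op_trace (\<lambda>x. \<Sum>q\<in>plane_index. A q *\<^sub>R plane_op q (plane_op r x)) = - real DIM(oct2) * A r"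
    if "r \<in> plane_index" for A r
  proof -
    have "op_trace (\<lambda>x. \<Sum>q\<in>plane_index. A q *\<^sub>R plane_op q (plane_op r x))
        = (\<Sum>q\<in>plane_index. A q * op_trace (\<lambda>x. plane_op q (plane_op r x)))"
      by (simp add: op_trace_def inner_sum_left sum_distrib_left) (rule sum.swap)
    also have "\<dots> = (\<Sum>q\<in>plane_index. if q = r then - real DIM(oct2) * A r else 0)"
      using that by (intro sum.cong) (auto simp: op_trace_plane_op)
    finally show ?thesis
      using that by simp
  qed
  \<comment> \<open>The inverse matrix is the transposed one, by cyclicity of the trace.\<close>
  have AB: "A p q = B q p" if p: "p \<in> plane_index" and q: "q \<in> plane_index" for p q
  proof -
    have lin: "linear (\<lambda>x. plane_op p (h (plane_op q x)))"
      using linear_compose[OF linear_compose[OF linear_plane_op lh] linear_plane_op] by (simp add: o_def)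
    have lin': "linear (\<lambda>x. h (plane_op q (g x)))"
      using linear_compose[OF linear_compose[OF lg linear_plane_op] lh] by (simp add: o_def)
    have "- real DIM(oct2) * A p q = op_trace (\<lambda>x. g (plane_op p (h (plane_op q x))))"
      unfolding A[OF p] tr[OF q] ..
    also have "\<dots> = op_trace (\<lambda>x. plane_op p (h (plane_op q (g x))))"
      by (rule op_trace_commute[OF lg lin])
    also have "\<dots> = op_trace (\<lambda>x. h (plane_op q (g (plane_op p x))))"
      by (rule op_trace_commute[OF linear_plane_op lin'])
    also have "\<dots> = - real DIM(oct2) * B q p"
      unfolding B[OF q] tr[OF p] ..
    finally show ?thesis by simp
  qed
  have expand: "plane_op q x = (\<Sum>p\<in>plane_index. A p q *\<^sub>R g (plane_op p (h x)))" if q: "q \<in> plane_index" for q x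
  proof -
    have "plane_op q x = g (h (plane_op q (g (h x))))"
      by (simp add: gh)
    also have "\<dots> = (\<Sum>p\<in>plane_index. B q p *\<^sub>R g (plane_op p (h x)))"
      unfolding B[OF q] by (simp add: linear_sum[OF lg] linear_scale[OF lg])
    also have "\<dots> = (\<Sum>p\<in>plane_index. A p q *\<^sub>R g (plane_op p (h x)))"
      by (intro sum.cong) (simp_all add: AB q)
    finally show ?thesis .
  qed
  define Y where "Y x = g (I_op j (h x))" for x
  have "linear Y"
    using linear_compose[OF linear_compose[OF lh linear_I_op[of j]] lg] by (simp add: Y_def[abs_def] o_def)
  moreover have "casimir Y x = - 20 *\<^sub>R Y x" for x
  proof -
    have "casimir Y x = (\<Sum>q\<in>plane_index. \<Sum>p\<in>plane_index. A p q *\<^sub>R g (plane_op p (I_op j (h (plane_op q x)))))"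
      unfolding casimir_def
    proof (intro sum.cong refl)
      fix q assume q: "q \<in> plane_index"
      show "plane_op q (Y (plane_op q x))
          = (\<Sum>p\<in>plane_index. A p q *\<^sub>R g (plane_op p (I_op j (h (plane_op q x)))))"
        by (subst expand[OF q]) (simp add: Y_def gh)
    qed
    also have "\<dots> = (\<Sum>p\<in>plane_index. g (plane_op p (I_op j (h (\<Sum>q\<in>plane_index. A p q *\<^sub>R plane_op q x)))))"
      by (subst sum.swap) (simp add: linear_sum[OF lg] linear_scale[OF lg] linear_sum[OF lh] linear_scale[OF lh]
        linear_sum[OF linear_plane_op] linear_scale[OF linear_plane_op] I_op_linear_simps)
    also have "\<dots> = (\<Sum>p\<in>plane_index. g (plane_op p (I_op j (plane_op p (h x)))))"
      by (intro sum.cong refl) (simp add: gh flip: A)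
    also have "\<dots> = g (casimir (I_op j) (h x))"
      by (simp add: casimir_def linear_sum[OF lg])
    finally show ?thesis
      by (simp add: casimir_I_op[OF j] Y_def linear_neg[OF lg] linear_scale[OF lg])
  qed
  ultimately obtain a where "Y = I_comb a"
    by (rule casimir_eigenspace)
  with that show thesis
    by (simp add: Y_def fun_eq_iff)
qed

lemma Omega8_scale: "Omega8 (\<lambda>k. c *\<^sub>R v k) = c ^ 8 * Omega8 v"
proof -
  have "varpi i j (\<lambda>k. c *\<^sub>R w k) = c\<^sup>2 * varpi i j w" for i j w
    by (simp add: varpi_def I_op_linear_simps power2_eq_square)
  moreover have "contraction (\<lambda>i j. r * A i j) (\<lambda>i j. r * B i j) (\<lambda>i j. r * C i j) (\<lambda>i j. r * D i j) = r ^ 4 * contraction A B C D"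
    for r A B C D
    by (simp add: contraction_def sum_distrib_left power4_eq_xxxx mult_ac)
  ultimately have "four_fold varpi (\<lambda>k. c *\<^sub>R w k) = c ^ 8 * four_fold varpi w" for w
    by (simp add: four_fold_def flip: power_mult)
  then show ?thesis
    by (simp add: Omega8_eq_Alt Alt_def sum_distrib_left mult_ac)
qed

text \<open>The operators \<open>g I\<^sub>j g\<inverse>\<close> satisfy the Clifford relations and belong to orthonormal vectors. After
  multiplication by an element \<open>k\<close> of the spin group that rotates these vectors to the standard ones,
  \<open>k g\<close> commutes with all generators up to the sign \<open>s\<close>. The volume element rules out \<open>s = - 1\<close>, so
  \<open>k g\<close> is a scalar, whose eighth power is 1.\<close>

lemma stabilizes_Omega8_imp_rho_Spin9:
  assumes g: "stabilizes_Omega8 g" and h: "stabilizes_Omega8 h" and gh: "\<And>x. g (h x) = x" "\<And>x. h (g x) = x"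
  shows "g \<in> rho_Spin9"
proof -
  have lg: "linear g"
    using g by (simp add: stabilizes_Omega8_def)
  have "\<exists>a. \<forall>j\<in>{..8}. \<forall>x. g (I_op j (h x)) = I_comb (a j) x"
  proof (rule bchoice, rule ballI)
    fix j :: nat assume "j \<in> {..8}"
    then have "j \<le> 8" by simp
    from conj_I_op_eq_I_comb[OF g h gh this] show "\<exists>a. \<forall>x. g (I_op j (h x)) = I_comb a x"
      by blast
  qed
  then obtain a where a: "\<And>j x. j \<le> 8 \<Longrightarrow> g (I_op j (h x)) = I_comb (a j) x"
    by auto
  have orth: "coeff_inner (a i) (a j) = (if i = j then 1 else 0)" if "i < 9" "j < 9" for i j
  proof -
    have ij: "i \<le> 8" "j \<le> 8" using that by auto
    have "(2 * coeff_inner (a i) (a j)) *\<^sub>R octonionic_line_frame 0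
        = g (I_op i (I_op j (h (octonionic_line_frame 0))) + I_op j (I_op i (h (octonionic_line_frame 0))))"
      unfolding I_comb_Clifford[symmetric] by (simp add: ij gh linear_add[OF lg] flip: a)
    also have "\<dots> = (if i = j then 2 else 0) *\<^sub>R octonionic_line_frame 0"
      by (simp only: I_op_Clifford[OF ij] linear_scale[OF lg] gh)
    finally have "(2 * coeff_inner (a i) (a j)) *\<^sub>R octonionic_line_frame 0 = (if i = j then 2 else 0) *\<^sub>R octonionic_line_frame 0" .
    moreover have "octonionic_line_frame 0 \<noteq> 0"
      by (simp add: octonionic_line_frame_def oct_unit_def prod_eq_iff)
    ultimately show ?thesis
      by (auto simp only: scaleR_cancel_right split: if_splits)
  qed
  obtain k s where k: "k \<in> rho_Spin9" and s: "s \<in> {1, - 1}"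
    and ka: "\<And>i x. i < 9 \<Longrightarrow> k (I_comb (a i) x) = s *\<^sub>R I_op i (k x)"
    using rho_Spin9_frame_to_basis[OF orth order.refl] by blast
  obtain k' where k': "k' \<in> rho_Spin9" "k' \<circ> k = id" "k \<circ> k' = id"
    using rho_Spin9_inverse[OF k] .
  define c where "c = k \<circ> g"
  have c: "stabilizes_Omega8 c"
    unfolding c_def using stabilizes_Omega8_comp[OF stabilizes_Omega8_rho_Spin9[OF k] g] .
  then have lc: "linear c"
    by (simp add: stabilizes_Omega8_def)
  have c_neq: "c x \<noteq> 0" if "x \<noteq> 0" for x
  proof
    assume "c x = 0"
    then have "h (k' (c x)) = 0"
      using stabilizes_Omega8_rho_Spin9[OF k'(1)] h by (simp add: stabilizes_Omega8_def linear_0)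
    moreover have "k' (k y) = y" for y
      using k'(2) by (metis comp_apply id_apply)
    ultimately show False
      using that by (simp add: c_def gh)
  qed
  have cI: "I_op i (c x) = s *\<^sub>R c (I_op i x)" if "i \<le> 8" for i x
  proof -
    have "c (I_op i x) = k (I_comb (a i) (g x))"
      using a[OF that, of "g x"] by (simp add: c_def gh)
    then show ?thesis
      using ka[of i "g x"] that s by (auto simp: c_def)
  qed
  have "octonionic_line_frame 0 \<noteq> 0"
    by (simp add: octonionic_line_frame_def oct_unit_def prod_eq_iff)
  then have "(\<Prod>i\<leftarrow>[0..<9]. s) = 1"
    using sign_pattern_prod[of c "\<lambda>i. s" "octonionic_line_frame 0"] lc s cI c_neq by (simp add: sign_pattern_def)
  then have s1: "s = 1"
    using s by (auto simp: upt_rec)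
  have "c (I_op i x) = I_op i (c x)" if "i \<le> 8" for i x
    using cI[OF that] by (simp add: s1)
  then obtain r where r: "\<And>x. c x = r *\<^sub>R x"
    using linear_eq_scaleR_if_commutes[OF lc] by blast
  have "r ^ 8 * Omega8 octonionic_line_frame = Omega8 octonionic_line_frame"
    using c Omega8_scale[of r octonionic_line_frame] by (simp add: stabilizes_Omega8_def r)
  then have "r ^ 8 = 1"
    using Omega8_octonionic_line by simp
  then have "\<bar>r\<bar> ^ 8 = 1 ^ 8"
    by (simp flip: power_abs)
  then have "\<bar>r\<bar> = 1"
    by (rule power_eq_imp_eq_base) simp_all
  have "g x = r *\<^sub>R k' x" for x
  proof -
    have "g x = k' (c x)"
      using k'(2) by (metis c_def comp_apply id_apply)
    then show ?thesis
      using stabilizes_Omega8_rho_Spin9[OF k'(1)] by (simp add: r stabilizes_Omega8_def linear_scale)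
  qed
  moreover have "(\<lambda>x. - k' x) \<in> rho_Spin9"
  proof -
    \<comment> \<open>The second vector is the negative of the first one, in the shape of a linear combination.\<close>
    let ?a = "coeff_unit 8" and ?b = "\<lambda>k. 0 * coeff_unit 8 k - 1 * coeff_unit 8 k"
    have unit: "coeff_inner ?a ?a = 1" "coeff_inner ?b ?b = 1"
      unfolding coeff_inner_linear by (simp_all) (simp_all add: coeff_unit_def)
    have "(\<lambda>x. - k' x) = I_comb ?a \<circ> (I_comb ?b \<circ> k')"
      by (simp only: fun_eq_iff o_apply I_comb_lincomb) (simp add: I_comb_coeff_unit I_op_linear_simps)
    then show ?thesis
      using rho_Spin9_I_comb(1)[OF unit(1) rho_Spin9_I_comb(1)[OF unit(2) k'(1)]] by simp
  qed
  moreover from \<open>\<bar>r\<bar> = 1\<close> have "r = 1 \<or> r = - 1"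
    by auto
  ultimately have "g = k' \<or> g = (\<lambda>x. - k' x)"
    by (auto simp: fun_eq_iff)
  with k'(1) \<open>(\<lambda>x. - k' x) \<in> rho_Spin9\<close> show ?thesis
    by auto
qed

theorem theorem3p1:
  "stabilizer (GL :: (oct2 \<Rightarrow> oct2) monoid) form_action Omega8 = rho_Spin9"
proof (rule subset_antisym; rule subsetI)
  fix g assume "g \<in> stabilizer (GL :: (oct2 \<Rightarrow> oct2) monoid) form_action Omega8"
  then have "g \<in> carrier GL" and stab: "form_action g Omega8 = Omega8"
    by (simp_all add: stabilizer_def)
  then have g: "linear g" "bij g"
    by (simp_all add: GL_def)
  have act: "Omega8 (\<lambda>i. inv_into UNIV g (v i)) = Omega8 v" for v
    using fun_cong[OF stab, of v] by (simp add: form_action_def)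
  define h where "h = inv_into UNIV g"
  have gh: "g (h x) = x" "h (g x) = x" for x
    using g(2) by (simp_all add: h_def bij_is_surj surj_f_inv_f bij_is_inj)
  have "linear h"
    unfolding h_def using g by (auto simp: bij_def intro: inj_linear_imp_inv_linear)
  then have "stabilizes_Omega8 h"
    using act by (simp add: stabilizes_Omega8_def h_def)
  moreover have "stabilizes_Omega8 g"
    unfolding stabilizes_Omega8_def
  proof (intro conjI allI g(1))
    show "Omega8 (\<lambda>i. g (v i)) = Omega8 v" for v
      using act[of "\<lambda>i. g (v i)"] by (simp add: gh flip: h_def)
  qed
  ultimately show "g \<in> rho_Spin9"
    using gh by (intro stabilizes_Omega8_imp_rho_Spin9)
next
  fix g assume g: "g \<in> rho_Spin9"
  obtain h where h: "h \<in> rho_Spin9" "h \<circ> g = id" "g \<circ> h = id"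
    using rho_Spin9_inverse[OF g] .
  have "inv_into UNIV g = h"
    using h(2,3) by (intro inv_unique_comp)
  moreover have "bij g"
    using h(2,3) by (rule o_bij)
  ultimately show "g \<in> stabilizer (GL :: (oct2 \<Rightarrow> oct2) monoid) form_action Omega8"
    using stabilizes_Omega8_rho_Spin9[OF g] stabilizes_Omega8_rho_Spin9[OF h(1)]
    by (simp add: stabilizer_def GL_def form_action_def stabilizes_Omega8_def)
qed

end
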